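(* Let $q$ and $s$ be integers. If there exists an antipodal tight graph $\mathrm{AT4}(qs,q,q)$, then $s\leq q$.
   Context: All graphs are finite and simple. A connected graph $\Gamma$ of diameter $d$ with distance function $\partial$ is distance-regular if for all $0\le i\le d$ and all vertices $x,y$ with $\partial(x,y)=i$ the numbers $a_i=|\Gamma_i(x)\cap\Gamma_1(y)|$, $b_i=|\Gamma_{i+1}(x)\cap\Gamma_1(y)|$, $c_i=|\Gamma_{i-1}(x)\cap\Gamma_1(y)|$ depend only on $i$, where $\Gamma_i(x)=\{y:\partial(x,y)=i\}$. Its valency is $k=b_0$. The local graph at $x$ is the subgraph induced on $\Gamma_1(x)$. Tight: let $\Gamma$ be distance-regular with diameter $d\ge3$ and eigenvalues $k=\theta_0>\theta_1>\dots>\theta_d$. Then $\Gamma$ is tight if it is not bipartite and $$\Big(\theta_1+\tfrac{k}{a_1+1}\Big)\Big(\theta_d+\tfrac{k}{a_1+1}\Big)=-\tfrac{ka_1b_1}{(a_1+1)^2}.$$ It is known that if $\Gamma$ is tight then every local graph is connected strongly regular with nontrivial eigenvalues (those other than the valency) $-1-b_1/(1+\theta_d)$ and $-1-b_1/(1+\theta_1)$. Antipodal: $\Gamma$ of diameter $d$ is antipodal if $\partial(x,y)=\partial(x,z)=d$ implies $y=z$ or $\partial(y,z)=d$; then being at distance $0$ or $d$ is an equivalence relation, whose classes are the antipodal classes, and $\Gamma$ is an antipodal $r$-cover if all classes have size $r$. An antipodal tight graph $\mathrm{AT4}(p,q,r)$ is a tight distance-regular graph of diameter $4$ that is an antipodal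 $r$-cover and whose local graphs have nontrivial eigenvalues $p$ and $-q$ with $p>-q$. It is known that then $p,q,r$ are integers with $p\ge1$, $q\ge2$, $r\ge2$, and that $\Gamma$ has intersection array $\{b_0,b_1,b_2,b_3;c_1,c_2,c_3,c_4\}=\{q(pq+p+q),(q^2-1)(p+1),(r-1)q(p+q)/r,1;\ 1,q(p+q)/r,(q^2-1)(p+1),q(pq+p+q)\}$. *)

theory Defs
  imports Complex_Main "Graph_Theory.Graph_Theory"
begin

text \<open>
  A finite simple graph is a digraph satisfying the locale predicate \<^const>\<open>graph\<close>: finite,
  loop-free, without parallel arcs, and with a symmetric arc relation, so that an undirected edge
  is a pair of opposite arcs.
\<close>

definition gdist :: "('v, 'e) pre_digraph \<Rightarrow> 'v \<Rightarrow> 'v \<Rightarrow> nat" where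
  "gdist G x y = (LEAST n. \<exists>p. pre_digraph.awalk G x p y \<and> length p = n)"

definition gdiam :: "('v, 'e) pre_digraph \<Rightarrow> nat" where
  "gdiam G = Max {gdist G x y | x y. x \<in> verts G \<and> y \<in> verts G}"

definition gsphere :: "('v, 'e) pre_digraph \<Rightarrow> nat \<Rightarrow> 'v \<Rightarrow> 'v set" where
  "gsphere G i x = {y \<in> verts G. gdist G x y = i}"

text \<open>
  In \<open>is_c\<close> the truncated index is harmless: for \<open>i = 0\<close> we have \<open>y = x\<close>, and the sphere of radius
  \<open>0\<close> around \<open>x\<close> is disjoint from that of radius \<open>1\<close>, so \<open>c\<^sub>0 = 0\<close> as required.
\<close>

definition is_a :: "('v, 'e) pre_digraph \<Rightarrow> nat \<Rightarrow> nat \<Rightarrow> bool" where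
  "is_a G i n \<longleftrightarrow> (\<forall>x\<in>verts G. \<forall>y\<in>verts G. gdist G x y = i \<longrightarrow>
     card (gsphere G i x \<inter> gsphere G 1 y) = n)"

definition is_b :: "('v, 'e) pre_digraph \<Rightarrow> nat \<Rightarrow> nat \<Rightarrow> bool" where
  "is_b G i n \<longleftrightarrow> (\<forall>x\<in>verts G. \<forall>y\<in>verts G. gdist G x y = i \<longrightarrow>
     card (gsphere G (i + 1) x \<inter> gsphere G 1 y) = n)"

definition is_c :: "('v, 'e) pre_digraph \<Rightarrow> nat \<Rightarrow> nat \<Rightarrow> bool" where
  "is_c G i n \<longleftrightarrow> (\<forall>x\<in>verts G. \<forall>y\<in>verts G. gdist G x y = i \<longrightarrow>
     card (gsphere G (i - 1) x \<inter> gsphere G 1 y) = n)"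

definition distance_regular :: "('v, 'e) pre_digraph \<Rightarrow> bool" where
  "distance_regular G \<longleftrightarrow> graph G \<and> Digraph_Component.connected G \<and>
     (\<forall>i\<le>gdiam G. (\<exists>n. is_a G i n) \<and> (\<exists>n. is_b G i n) \<and> (\<exists>n. is_c G i n))"

text \<open>
  The intersection numbers. For a distance-regular \<open>G\<close> and \<open>i \<le> gdiam G\<close> the descriptions are
  proper, since some pair of vertices is at distance \<open>i\<close>.
\<close>

definition inter_a :: "('v, 'e) pre_digraph \<Rightarrow> nat \<Rightarrow> nat" where
  "inter_a G i = (THE n. is_a G i n)"

definition inter_b :: "('v, 'e) pre_digraph \<Rightarrow> nat \<Rightarrow> nat" where
  "inter_b G i = (THE n. is_b G i n)"

definition local_graph :: "('v, 'e) pre_digraph \<Rightarrow> 'v \<Rightarrow> ('v, 'e) pre_digraph" where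
  "local_graph G x = G \<restriction> gsphere G 1 x"

text \<open>
  Eigenvalues of the adjacency matrix, viewed as acting on real functions on the vertex set.
  The matrix is symmetric, so real eigenvalues are all of them.
\<close>

definition graph_eigenvalue :: "('v, 'e) pre_digraph \<Rightarrow> real \<Rightarrow> bool" where
  "graph_eigenvalue G \<theta> \<longleftrightarrow> (\<exists>f :: 'v \<Rightarrow> real. (\<exists>x\<in>verts G. f x \<noteq> 0) \<and>
     (\<forall>x\<in>verts G. (\<Sum>y | y \<in> verts G \<and> x \<rightarrow>\<^bsub>G\<^esub> y. f y) = \<theta> * f x))"

definition nontrivial_eigenvalues :: "('v, 'e) pre_digraph \<Rightarrow> real set" where
  "nontrivial_eigenvalues G =
     {\<theta>. graph_eigenvalue G \<theta>} - {real k | k. \<forall>x\<in>verts G. out_degree G x = k}"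

definition bipartite :: "('v, 'e) pre_digraph \<Rightarrow> bool" where
  "bipartite G \<longleftrightarrow> (\<exists>A B. verts G = A \<union> B \<and> A \<inter> B = {} \<and>
     (\<forall>x y. x \<rightarrow>\<^bsub>G\<^esub> y \<longrightarrow> (x \<in> A \<and> y \<in> B) \<or> (x \<in> B \<and> y \<in> A)))"

definition tight :: "('v, 'e) pre_digraph \<Rightarrow> bool" where
  "tight G \<longleftrightarrow> distance_regular G \<and> gdiam G \<ge> 3 \<and> \<not> bipartite G \<and>
     (let d = gdiam G; k = real (inter_b G 0); a1 = real (inter_a G 1); b1 = real (inter_b G 1)
      in \<exists>\<theta> :: nat \<Rightarrow> real. \<theta> ` {0..d} = {t. graph_eigenvalue G t} \<and>
           \<theta> 0 = k \<and> (\<forall>i<d. \<theta> (Suc i) < \<theta> i) \<and>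
           (\<theta> 1 + k / (a1 + 1)) * (\<theta> d + k / (a1 + 1)) = - (k * a1 * b1 / (a1 + 1)^2))"

definition antipodal :: "('v, 'e) pre_digraph \<Rightarrow> bool" where
  "antipodal G \<longleftrightarrow> (\<forall>x\<in>verts G. \<forall>y\<in>verts G. \<forall>z\<in>verts G.
     gdist G x y = gdiam G \<and> gdist G x z = gdiam G \<longrightarrow> y = z \<or> gdist G y z = gdiam G)"

definition antipodal_class :: "('v, 'e) pre_digraph \<Rightarrow> 'v \<Rightarrow> 'v set" where
  "antipodal_class G x = {y \<in> verts G. gdist G x y = 0 \<or> gdist G x y = gdiam G}"

definition antipodal_cover :: "('v, 'e) pre_digraph \<Rightarrow> int \<Rightarrow> bool" where
  "antipodal_cover G r \<longleftrightarrow> antipodal G \<and> (\<forall>x\<in>verts G. int (card (antipodal_class G x)) = r)"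

definition AT4 :: "('v, 'e) pre_digraph \<Rightarrow> real \<Rightarrow> real \<Rightarrow> int \<Rightarrow> bool" where
  "AT4 G p q r \<longleftrightarrow> tight G \<and> gdiam G = 4 \<and> antipodal_cover G r \<and> p > - q \<and>
     (\<forall>x\<in>verts G. nontrivial_eigenvalues (local_graph G x) = {p, - q})"

end

theory Submission
  imports Defs
begin

text \<open>
  Why \<open>s \<le> q\<close>. Fix a vertex \<open>x\<close> of an \<open>AT4(qs,q,q)\<close> and let \<open>\<Delta>\<close> be its local graph. The graph \<open>\<Delta>\<close>
  is strongly regular with valency \<open>qs(q+1)\<close>, with \<open>q(2s-1)\<close> common neighbours for an edge and \<open>qs\<close>
  for a non-edge. Moreover two vertices of the big graph at distance two have \<open>q(s+1)\<close> common
  neighbours, and each of these is non-adjacent to exactly \<open>q-1\<close> of the others. The bound follows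
  from these facts by looking, for an edge \<open>yz\<close> of \<open>\<Delta>\<close>, at the graph induced on the set \<open>T\<close> of
  common neighbours of \<open>y\<close> and \<open>z\<close> in \<open>\<Delta>\<close>.

  On the one hand \<open>T\<close> must have many edges: \<open>qA + q\<^sup>2I - J\<close> is a positive multiple of a projection,
  hence positive semidefinite, and testing it on the indicator of \<open>T\<close>, corrected at \<open>y\<close> and \<open>z\<close>,
  bounds the number of edges from below (\<open>edge_link_lower\<close>). On the other hand a neighbour of
  \<open>y\<close> that is not adjacent to \<open>z\<close> still has at least \<open>q(s-1)\<close> neighbours in \<open>T\<close>, and these are
  edges leaving \<open>T\<close>, which bounds the number of edges inside \<open>T\<close> from above (\<open>edge_link_upper\<close>).
  Together these give \<open>(q-2)s \<le> q\<close>, which is more than enough for \<open>q \<ge> 3\<close>.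

  For \<open>q = 2\<close> this inequality is void, but then non-adjacency among the common neighbours of two
  vertices at distance two is a perfect matching. This makes \<open>\<Delta>\<close> claw-free, and the neighbours of
  a vertex \<open>w\<close> that are not adjacent to a fixed non-neighbour \<open>w'\<close> fall into classes of size \<open>s+1\<close>
  according to their traces on the common neighbours of \<open>w\<close> and \<open>w'\<close>. There are \<open>4s\<close> of them, and
  if \<open>s \<ge> 3\<close> they need at least four classes, a contradiction (\<open>q_two_bound\<close>).

  It remains to see why \<open>\<Delta>\<close> has these parameters. Antipodality determines enough of the
  intersection array to show that every eigenvalue other than the valency is a root of one of two
  quadratic polynomials whose roots interlace (\<open>eigenvalue_cases\<close>). If \<open>-Q\<close> is the negative root
  of the first one, tightness says that the least eigenvalue is \<open>-Q\<^sup>2\<close>, and this expresses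
  the array by two numbers \<open>P\<close> and \<open>Q\<close> (\<open>tight_parameters\<close>). The cosine sequences of the second
  largest and of the least eigenvalue yield positive semidefinite matrices, which on \<open>\<Delta>\<close> are
  positive multiples of \<open>A + Q - J/Q\<close> and of \<open>P - A\<close> plus a multiple of \<open>J\<close>. Tightness makes the
  trace of their product vanish, so the product itself vanishes; this quadratic equation for \<open>A\<close>
  is the strong regularity of \<open>\<Delta>\<close>, with nontrivial eigenvalues \<open>P\<close> and \<open>-Q\<close>
  (\<open>local_codegree\<close>, \<open>local_eigenvalue\<close>). Hence \<open>P = qs\<close> and \<open>Q = q\<close>.
\<close>

section \<open>Kernels on finite sets\<close>

lemma sum_of_bool_card:
  assumes "finite A"
  shows "(\<Sum>x\<in>A. of_bool (P x) :: real) = real (card {x \<in> A. P x})"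
  using assms by (simp add: of_bool_def sum.If_cases Int_def)

text \<open>
  A kernel that only sees equality and adjacency is a combination of \<open>J\<close>, \<open>A\<close> and \<open>I\<close>; multiplying out
  two of them involves nothing but the order, two valencies and one codegree. The formula serves
  both to recognise a projection in a strongly regular graph and, read backwards, to extract
  codegrees from a vanishing product.
\<close>

lemma kernel_product:
  fixes a b c a' b' c' :: real and D :: "'v set" and adj :: "'v \<Rightarrow> 'v \<Rightarrow> bool"
  assumes fin: "finite D" and xD: "x \<in> D" and yD: "y \<in> D"
    and sym: "\<And>u v. u \<in> D \<Longrightarrow> v \<in> D \<Longrightarrow> adj u v = adj v u"
  shows "(\<Sum>z\<in>D. (a + b * of_bool (adj x z) + c * of_bool (x = z)) *
                    (a' + b' * of_bool (adj z y) + c' * of_bool (z = y))) =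
     a * a' * real (card D) + a * b' * real (card {z \<in> D. adj y z}) + a * c'
     + b * a' * real (card {z \<in> D. adj x z})
     + b * b' * real (card ({z \<in> D. adj x z} \<inter> {z \<in> D. adj y z}))
     + b * c' * of_bool (adj x y) + c * a' + c * b' * of_bool (adj x y)
     + c * c' * of_bool (x = y)"
proof -
  have common: "{z \<in> D. adj x z \<and> adj y z} = {z \<in> D. adj x z} \<inter> {z \<in> D. adj y z}" by auto
  have "(\<Sum>z\<in>D. (a + b * of_bool (adj x z) + c * of_bool (x = z)) *
                    (a' + b' * of_bool (adj z y) + c' * of_bool (z = y))) =
    (\<Sum>z\<in>D. a * a' + a * b' * of_bool (adj y z) + (if z = y then a * c' else 0)
       + b * a' * of_bool (adj x z) + b * b' * of_bool (adj x z \<and> adj y z)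
       + (if z = y then b * c' * of_bool (adj x y) else 0) + (if z = x then c * a' else 0)
       + (if z = x then c * b' * of_bool (adj x y) else 0)
       + (if z = x then c * c' * of_bool (x = y) else 0))"
    by (rule sum.cong) (auto simp: sym[OF _ yD] algebra_simps)
  also have "\<dots> = a * a' * real (card D) + a * b' * (\<Sum>z\<in>D. of_bool (adj y z)) + a * c'
     + b * a' * (\<Sum>z\<in>D. of_bool (adj x z)) + b * b' * (\<Sum>z\<in>D. of_bool (adj x z \<and> adj y z))
     + b * c' * of_bool (adj x y) + c * a' + c * b' * of_bool (adj x y)
     + c * c' * of_bool (x = y)"
    using fin xD yD by (simp only: sum.distrib sum_distrib_left[symmetric] sum.delta) simp
  finally show ?thesis
    unfolding sum_of_bool_card[OF fin] common .
qed

text \<open>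
  The matrix form of \<open>tr XY = 0 \<Longrightarrow> XY = 0\<close> for positive semidefinite \<open>X\<close>, \<open>Y\<close>. With Gram
  representations \<open>X = F\<^sup>TF\<close> and \<open>Y = G\<^sup>TG\<close>, the trace of \<open>XY\<close> is the sum of the squares of the entries
  of \<open>FG\<^sup>T\<close>, and \<open>XY = F\<^sup>T(FG\<^sup>T)G\<close>.
\<close>

lemma gram_trace_zero:
  fixes X Y :: "'v \<Rightarrow> 'v \<Rightarrow> real" and f :: "'u \<Rightarrow> 'v \<Rightarrow> real" and g :: "'w \<Rightarrow> 'v \<Rightarrow> real"
  assumes fin: "finite U" "finite W"
    and X: "\<And>y z. y \<in> D \<Longrightarrow> z \<in> D \<Longrightarrow> X y z = (\<Sum>u\<in>U. f u y * f u z)"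
    and Y: "\<And>y z. y \<in> D \<Longrightarrow> z \<in> D \<Longrightarrow> Y y z = (\<Sum>v\<in>W. g v y * g v z)"
    and trace: "(\<Sum>y\<in>D. \<Sum>z\<in>D. X y z * Y y z) = 0"
    and y: "y \<in> D" and w: "w \<in> D"
  shows "(\<Sum>z\<in>D. X y z * Y z w) = 0"
proof -
  define h where "h u v = (\<Sum>z\<in>D. f u z * g v z)" for u v
  have "(\<Sum>u\<in>U. \<Sum>v\<in>W. (h u v)\<^sup>2) =
      (\<Sum>u\<in>U. \<Sum>v\<in>W. \<Sum>y\<in>D. \<Sum>z\<in>D. (f u y * f u z) * (g v y * g v z))"
    by (simp add: h_def power2_eq_square sum_product mult_ac)
  also have "\<dots> = (\<Sum>u\<in>U. \<Sum>y\<in>D. \<Sum>v\<in>W. \<Sum>z\<in>D. (f u y * f u z) * (g v y * g v z))"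
    by (rule sum.cong[OF refl]) (rule sum.swap)
  also have "\<dots> = (\<Sum>y\<in>D. \<Sum>u\<in>U. \<Sum>v\<in>W. \<Sum>z\<in>D. (f u y * f u z) * (g v y * g v z))"
    by (rule sum.swap)
  also have "\<dots> = (\<Sum>y\<in>D. \<Sum>z\<in>D. X y z * Y y z)"
  proof (rule sum.cong[OF refl])
    fix y assume yD: "y \<in> D"
    have "(\<Sum>u\<in>U. \<Sum>v\<in>W. \<Sum>z\<in>D. (f u y * f u z) * (g v y * g v z)) =
        (\<Sum>u\<in>U. \<Sum>z\<in>D. \<Sum>v\<in>W. (f u y * f u z) * (g v y * g v z))"
      by (rule sum.cong[OF refl]) (rule sum.swap)
    also have "\<dots> = (\<Sum>z\<in>D. \<Sum>u\<in>U. \<Sum>v\<in>W. (f u y * f u z) * (g v y * g v z))" by (rule sum.swap)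
    also have "\<dots> = (\<Sum>z\<in>D. X y z * Y y z)"
      by (rule sum.cong[OF refl]) (simp add: X Y yD sum_product)
    finally show "(\<Sum>u\<in>U. \<Sum>v\<in>W. \<Sum>z\<in>D. (f u y * f u z) * (g v y * g v z)) = \<dots>" .
  qed
  finally have z: "(\<Sum>u\<in>U. \<Sum>v\<in>W. (h u v)\<^sup>2) = 0" using trace by simp
  have h0: "h u v = 0" if "u \<in> U" "v \<in> W" for u v
  proof -
    have "(\<Sum>v\<in>W. (h u v)\<^sup>2) = 0"
      using z that(1) fin by (subst (asm) sum_nonneg_eq_0_iff) (auto intro: sum_nonneg)
    then show ?thesis using that(2) fin by (subst (asm) sum_nonneg_eq_0_iff) auto
  qed
  have "(\<Sum>z\<in>D. X y z * Y z w) = (\<Sum>z\<in>D. \<Sum>u\<in>U. \<Sum>v\<in>W. (f u y * g v w) * (f u z * g v z))"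
    by (rule sum.cong[OF refl]) (simp add: X Y y w sum_product mult_ac)
  also have "\<dots> = (\<Sum>u\<in>U. \<Sum>z\<in>D. \<Sum>v\<in>W. (f u y * g v w) * (f u z * g v z))" by (rule sum.swap)
  also have "\<dots> = (\<Sum>u\<in>U. \<Sum>v\<in>W. \<Sum>z\<in>D. (f u y * g v w) * (f u z * g v z))"
    by (rule sum.cong[OF refl]) (rule sum.swap)
  also have "\<dots> = (\<Sum>u\<in>U. \<Sum>v\<in>W. (f u y * g v w) * h u v)" by (simp add: h_def sum_distrib_left)
  also have "\<dots> = 0" by (simp add: h0)
  finally show ?thesis .
qed

text \<open>
  A monic quadratic that is negative at \<open>-1\<close> has a root on either side of it. Both quadratics that
  govern the spectrum take the value \<open>-b\<^sub>1\<close> there.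
\<close>

lemma quadratic_split_at_minus_one:
  fixes m n :: real
  assumes "1 - m + n < 0"
  shows "\<exists>u v. u < -1 \<and> -1 < v \<and> u + v = - m \<and> u * v = n"
proof -
  define D where "D = m\<^sup>2 - 4 * n"
  have "(m - 2)\<^sup>2 < D" using assms by (simp add: D_def power2_eq_square algebra_simps)
  then have "0 < D" and lt: "\<bar>m - 2\<bar> < sqrt D"
    by (smt (verit) zero_le_power2, metis real_less_rsqrt power2_abs)
  then have s: "sqrt D * sqrt D = D" by simp
  show ?thesis
  proof (intro exI conjI)
    show "(- m - sqrt D) / 2 < -1" "-1 < (- m + sqrt D) / 2" using lt by auto
    show "(- m - sqrt D) / 2 * ((- m + sqrt D) / 2) = n"
      using s by (simp add: D_def power2_eq_square field_simps)
    show "(- m - sqrt D) / 2 + (- m + sqrt D) / 2 = - m" by (simp add: field_simps)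
  qed
qed

section \<open>Strongly regular graphs with the parameters of the local graphs\<close>

text \<open>
  The local graphs of an \<open>AT4(qs,q,q)\<close>. The assumption \<open>few_nonneighbours\<close> is inherited from the graph
  on all common neighbours of two vertices at distance two, where a vertex has exactly \<open>q - 1\<close>
  non-neighbours. Only those that lie in the local graph count here, whence an inequality.
\<close>

locale local_srg =
  fixes D :: "'v set" and adj :: "'v \<Rightarrow> 'v \<Rightarrow> bool" and q s :: nat
  assumes finite_D: "finite D"
    and adj_sym: "\<And>x y. x \<in> D \<Longrightarrow> y \<in> D \<Longrightarrow> adj x y = adj y x"
    and adj_irrefl: "\<And>x. x \<in> D \<Longrightarrow> \<not> adj x x"
    and q_ge_2: "2 \<le> q" and s_ge_1: "1 \<le> s"
    and card_D: "card D = q\<^sup>2 * (q * s + s + 1)"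
    and valency: "\<And>x. x \<in> D \<Longrightarrow> card {z \<in> D. adj x z} = q * s * (q + 1)"
    and adjacent_codegree: "\<And>x y. x \<in> D \<Longrightarrow> y \<in> D \<Longrightarrow> adj x y \<Longrightarrow>
      card ({z \<in> D. adj x z} \<inter> {z \<in> D. adj y z}) + q = 2 * q * s"
    and nonadjacent_codegree: "\<And>x y. x \<in> D \<Longrightarrow> y \<in> D \<Longrightarrow> x \<noteq> y \<Longrightarrow> \<not> adj x y \<Longrightarrow>
      card ({z \<in> D. adj x z} \<inter> {z \<in> D. adj y z}) = q * s"
    and few_nonneighbours: "\<And>x w y. x \<in> D \<Longrightarrow> w \<in> D \<Longrightarrow> x \<noteq> w \<Longrightarrow> \<not> adj x w \<Longrightarrow>
      y \<in> D \<Longrightarrow> adj x y \<Longrightarrow> adj w y \<Longrightarrow>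
      card {z \<in> D. adj x z \<and> adj w z \<and> z \<noteq> y \<and> \<not> adj y z} < q"
begin

definition nb :: "'v \<Rightarrow> 'v set" where "nb x = {z \<in> D. adj x z}"

lemma finite_nb [simp]: "finite (nb x)" and nb_subset: "nb x \<subseteq> D"
  using finite_D by (auto simp: nb_def)

text \<open>
  The matrix \<open>qA + q\<^sup>2I - J\<close>, a positive multiple of the projection onto the eigenspace of the
  eigenvalue \<open>qs\<close>: the other nontrivial eigenvalue is \<open>-q\<close>, and the row sums are zero.
\<close>

definition gram :: "'v \<Rightarrow> 'v \<Rightarrow> real" where
  "gram x y = -1 + real q * of_bool (adj x y) + (real q)\<^sup>2 * of_bool (x = y)"

lemma gram_square:
  assumes "x \<in> D" "y \<in> D"
  shows "(\<Sum>z\<in>D. gram x z * gram z y) = (real q)\<^sup>2 * (real s + 1) * gram x y"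
proof -
  have P: "(\<Sum>z\<in>D. gram x z * gram z y) =
     real (card D) - real q * real (card {z \<in> D. adj y z}) - (real q)\<^sup>2
     - real q * real (card {z \<in> D. adj x z})
     + real q * real q * real (card ({z \<in> D. adj x z} \<inter> {z \<in> D. adj y z}))
     + 2 * real q * (real q)\<^sup>2 * of_bool (adj x y) - (real q)\<^sup>2
     + (real q)\<^sup>2 * (real q)\<^sup>2 * of_bool (x = y)"
    unfolding gram_def
    using kernel_product[where adj = adj and a = "-1" and b = "real q" and c = "(real q)\<^sup>2"
        and a' = "-1" and b' = "real q" and c' = "(real q)\<^sup>2", OF finite_D assms adj_sym]
    by simp
  have n: "real (card D) = (real q)\<^sup>2 * (real q * real s + real s + 1)"
    and k: "real (card {z \<in> D. adj x z}) = real q * real s * (real q + 1)"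
           "real (card {z \<in> D. adj y z}) = real q * real s * (real q + 1)"
    unfolding card_D valency[OF assms(1)] valency[OF assms(2)] by (simp_all add: algebra_simps)
  let ?c = "real (card ({z \<in> D. adj x z} \<inter> {z \<in> D. adj y z}))"
  consider (eq) "x = y" | (adj) "x \<noteq> y" "adj x y" | (nonadj) "x \<noteq> y" "\<not> adj x y" by blast
  then show ?thesis
  proof cases
    case eq
    then have e: "of_bool (adj x y) = (0::real)" "of_bool (x = y) = (1::real)"
      using adj_irrefl assms by auto
    have c: "?c = real q * real s * (real q + 1)" using eq k by simp
    show ?thesis unfolding P c n k unfolding gram_def e by algebra
  next
    case adj
    then have e: "of_bool (adj x y) = (1::real)" "of_bool (x = y) = (0::real)" by auto
    have "real (card ({z \<in> D. adj x z} \<inter> {z \<in> D. adj y z}) + q) = real (2 * q * s)"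
      using adjacent_codegree[OF assms adj(2)] by presburger
    then have c: "?c = 2 * real q * real s - real q" by simp
    show ?thesis unfolding P c n k unfolding gram_def e by algebra
  next
    case nonadj
    then have e: "of_bool (adj x y) = (0::real)" "of_bool (x = y) = (0::real)" by auto
    have c: "?c = real q * real s" using nonadjacent_codegree[OF assms nonadj] by simp
    show ?thesis unfolding P c n k unfolding gram_def e by algebra
  qed
qed

text \<open>
  A symmetric matrix whose square is a positive multiple of itself is positive semidefinite.
\<close>

lemma gram_psd: "0 \<le> (\<Sum>x\<in>D. \<Sum>y\<in>D. gram x y * f x * f y)"
proof -
  have k_sym: "gram x z = gram z x" if "x \<in> D" "z \<in> D" for x z
    using adj_sym[OF that] by (auto simp: gram_def)
  have "0 \<le> (\<Sum>z\<in>D. (\<Sum>x\<in>D. gram x z * f x)\<^sup>2)" by (rule sum_nonneg) simp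
  also have "\<dots> = (\<Sum>z\<in>D. \<Sum>x\<in>D. \<Sum>y\<in>D. (gram x z * gram z y) * (f x * f y))"
  proof (intro sum.cong refl)
    fix z assume z: "z \<in> D"
    have "(\<Sum>x\<in>D. gram x z * f x)\<^sup>2 = (\<Sum>x\<in>D. gram x z * f x) * (\<Sum>y\<in>D. gram z y * f y)"
      using k_sym z by (simp add: power2_eq_square cong: sum.cong)
    also have "\<dots> = (\<Sum>x\<in>D. \<Sum>y\<in>D. (gram x z * gram z y) * (f x * f y))"
      by (simp add: sum_product mult_ac)
    finally show "(\<Sum>x\<in>D. gram x z * f x)\<^sup>2 = \<dots>" .
  qed
  also have "\<dots> = (\<Sum>x\<in>D. \<Sum>z\<in>D. \<Sum>y\<in>D. (gram x z * gram z y) * (f x * f y))" by (rule sum.swap)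
  also have "\<dots> = (\<Sum>x\<in>D. \<Sum>y\<in>D. \<Sum>z\<in>D. (gram x z * gram z y) * (f x * f y))" 
    by (rule sum.cong[OF refl]) (rule sum.swap)
  also have "\<dots> = (\<Sum>x\<in>D. \<Sum>y\<in>D. ((real q)\<^sup>2 * (real s + 1) * gram x y) * (f x * f y))"
    by (intro sum.cong refl) (simp add: sum_distrib_right[symmetric] gram_square)
  also have "\<dots> = (real q)\<^sup>2 * (real s + 1) * (\<Sum>x\<in>D. \<Sum>y\<in>D. gram x y * f x * f y)"
    by (simp add: sum_distrib_left mult_ac)
  finally have "0 \<le> (real q)\<^sup>2 * (real s + 1) * (\<Sum>x\<in>D. \<Sum>y\<in>D. gram x y * f x * f y)" .
  moreover have "0 < (real q)\<^sup>2 * (real s + 1)" using q_ge_2 by simp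
  ultimately show ?thesis by (meson linorder_not_le mult_pos_neg)
qed

lemma gram_quadratic_form:
  "(\<Sum>x\<in>D. \<Sum>y\<in>D. gram x y * f x * f y) =
     (real q)\<^sup>2 * (\<Sum>x\<in>D. (f x)\<^sup>2) + real q * (\<Sum>x\<in>D. f x * (\<Sum>y\<in>nb x. f y)) - (\<Sum>x\<in>D. f x)\<^sup>2"
proof -
  have "(\<Sum>y\<in>D. gram x y * f x * f y) =
      (real q)\<^sup>2 * (f x)\<^sup>2 + real q * (f x * (\<Sum>y\<in>nb x. f y)) - f x * (\<Sum>y\<in>D. f y)" if "x \<in> D" for x
  proof -
    have nbs: "(\<Sum>y\<in>nb x. f y) = (\<Sum>y\<in>D. of_bool (adj x y) * f y)"
      unfolding nb_def using finite_D by (simp only: sum.inter_filter) (intro sum.cong refl, simp)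
    have "(\<Sum>y\<in>D. gram x y * f x * f y) = (\<Sum>y\<in>D. (if y = x then (real q)\<^sup>2 * (f x)\<^sup>2 else 0)
        + (real q * f x) * (of_bool (adj x y) * f y) - f x * f y)"
      by (intro sum.cong refl) (auto simp: gram_def algebra_simps power2_eq_square)
    also have "\<dots> = (real q)\<^sup>2 * (f x)\<^sup>2 + (real q * f x) * (\<Sum>y\<in>nb x. f y) - f x * (\<Sum>y\<in>D. f y)"
      using finite_D that
      by (simp only: sum.distrib sum_subtractf sum_distrib_left[symmetric] nbs sum.delta) simp
    finally show ?thesis by simp
  qed
  then have "(\<Sum>x\<in>D. \<Sum>y\<in>D. gram x y * f x * f y) = (\<Sum>x\<in>D. (real q)\<^sup>2 * (f x)\<^sup>2 
      + real q * (f x * (\<Sum>y\<in>nb x. f y)) - f x * (\<Sum>y\<in>D. f y))" by simp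
  then show ?thesis
    by (simp add: sum.distrib sum_subtractf sum_distrib_left[symmetric] sum_distrib_right[symmetric]
        power2_eq_square)
qed

text \<open>
  Positive semidefiniteness tested on the indicator of the common neighbours of \<open>y\<close> and \<open>z\<close>, minus a
  multiple of that of \<open>{y, z}\<close>. The sum on the right is twice the number of edges among these common
  neighbours.
\<close>

lemma edge_link_lower:
  assumes y: "y \<in> D" and z: "z \<in> nb y"
  shows "3 * (real (card (nb y \<inter> nb z)))\<^sup>2 \<le> 
    (real q + 2) * (real q * real (card (nb y \<inter> nb z)) + (\<Sum>v\<in>nb y \<inter> nb z. real (card (nb y \<inter> nb z \<inter> nb v))))"
proof -
  define T where "T = nb y \<inter> nb z"
  define N where "N = real (card T)"
  define S where "S = (\<Sum>v\<in>T. real (card (T \<inter> nb v)))"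
  \<comment> \<open>This value of \<open>t\<close> minimises the quadratic form.\<close>
  define t where "t = N / (real q + 2)"
  define f where "f x = of_bool (x \<in> T) - t * of_bool (x = y) - t * of_bool (x = z)" for x
  have zD: "z \<in> D" and yz: "adj y z" "adj z y" using z y adj_sym by (auto simp: nb_def)
  have yz': "y \<noteq> z" using yz adj_irrefl y by blast
  have TD: "T \<subseteq> D" by (auto simp: T_def nb_def)
  have T: "v \<in> D" "adj y v" "adj z v" "adj v y" "adj v z" "v \<noteq> y" "v \<noteq> z" if "v \<in> T" for v
    using that y zD adj_irrefl adj_sym by (auto simp: T_def nb_def)
  have sumT: "(\<Sum>x\<in>A. of_bool (x \<in> T) * g x) = (\<Sum>x\<in>A \<inter> T. g x)" if "finite A" for A and g :: "_ \<Rightarrow> real"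
    using that by (simp only: sum.inter_restrict) (intro sum.cong refl, simp)
  have DT: "D \<inter> T = T" using TD by blast
  have s1: "(\<Sum>x\<in>D. f x) = N - 2 * t"
    using y zD finite_D sumT[OF finite_D, of "\<lambda>_. 1"]
    by (simp add: f_def sum_subtractf of_bool_def DT N_def flip: sum_distrib_left)
  have "(\<Sum>x\<in>D. (f x)\<^sup>2) = (\<Sum>x\<in>D. of_bool (x \<in> T) * 1 + (if x = y then t\<^sup>2 else 0) + (if x = z then t\<^sup>2 else 0))"
    using T(6,7) yz' by (intro sum.cong refl) (auto simp: f_def)
  also have "\<dots> = N + 2 * t\<^sup>2"
    using y zD finite_D by (simp only: sum.distrib sumT[OF finite_D] DT) (simp add: N_def)
  finally have s2: "(\<Sum>x\<in>D. (f x)\<^sup>2) = N + 2 * t\<^sup>2" .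
  have nbf: "(\<Sum>w\<in>nb x. f w) = real (card (T \<inter> nb x)) - t * of_bool (adj x y) - t * of_bool (adj x z)" for x
    using y zD sumT[OF finite_nb, of "\<lambda>_. 1" x]
    by (simp add: f_def sum_subtractf of_bool_def nb_def Int_commute finite_D flip: sum_distrib_left)
  have "(\<Sum>x\<in>D. f x * (\<Sum>y\<in>nb x. f y)) = (\<Sum>x\<in>D. of_bool (x \<in> T) * (real (card (T \<inter> nb x)) - 2 * t)
      + (if x = y then - t * (N - t) else 0) + (if x = z then - t * (N - t) else 0))"
  proof (intro sum.cong refl)
    fix x assume "x \<in> D"
    have "T \<inter> nb y = T" "T \<inter> nb z = T" by (auto simp: T_def)
    then show "f x * (\<Sum>y\<in>nb x. f y) = of_bool (x \<in> T) * (real (card (T \<inter> nb x)) - 2 * t)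
      + (if x = y then - t * (N - t) else 0) + (if x = z then - t * (N - t) else 0)"
      unfolding nbf unfolding f_def using T yz yz' adj_irrefl y zD 
      by (cases "x \<in> T") (auto simp: N_def)
  qed
  also have "\<dots> = S - 2 * t * N - 2 * t * (N - t)"
    using y zD finite_D
    by (simp only: sum.distrib sumT[OF finite_D] DT) (simp add: N_def S_def sum_subtractf)
  finally have s3: "(\<Sum>x\<in>D. f x * (\<Sum>y\<in>nb x. f y)) = S - 2 * t * N - 2 * t * (N - t)" .
  have "0 \<le> (real q)\<^sup>2 * (N + 2 * t\<^sup>2) + real q * (S - 2 * t * N - 2 * t * (N - t)) - (N - 2 * t)\<^sup>2"
    using gram_psd[of f] unfolding gram_quadratic_form s1 s2 s3 .
  also have "\<dots> = (real q)\<^sup>2 * N + real q * S - N\<^sup>2 + 2 * (real q - 1) * t * ((real q + 2) * t) - 4 * t * N * (real q - 1)"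
    by (simp add: algebra_simps power2_eq_square)
  also have "(real q + 2) * t = N" by (simp add: t_def)
  finally have "0 \<le> (real q)\<^sup>2 * N + real q * S - N\<^sup>2 - 2 * (real q - 1) * t * N"
    by (simp add: algebra_simps)
  then have "0 \<le> (real q + 2) * ((real q)\<^sup>2 * N + real q * S - N\<^sup>2 - 2 * (real q - 1) * t * N)"
    by simp
  also have "\<dots> = (real q + 2) * ((real q)\<^sup>2 * N + real q * S - N\<^sup>2) - 2 * (real q - 1) * N * ((real q + 2) * t)"
    by (simp add: algebra_simps)
  also have "(real q + 2) * t = N" by (simp add: t_def)
  finally have "0 \<le> real q * ((real q + 2) * (real q * N + S) - 3 * N\<^sup>2)"
    by (simp add: algebra_simps power2_eq_square)
  then show ?thesis using q_ge_2 by (simp add: zero_le_mult_iff N_def S_def T_def)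
qed

text \<open>
  Two-step paths \<open>z, v, w\<close> inside the neighbourhood of \<open>y\<close> that end at a vertex \<open>w\<close> not adjacent to
  \<open>z\<close>: each \<open>w\<close> is reached at least \<open>q(s - 1)\<close> times, because \<open>z\<close> and \<open>w\<close> have \<open>qs\<close> common neighbours
  and at most \<open>q\<close> of these, \<open>y\<close> included, fail to be adjacent to \<open>y\<close>. Every such path uses up one of
  the neighbours that \<open>v\<close> could have had among the common neighbours of \<open>y\<close> and \<open>z\<close>.
\<close>

lemma edge_link_upper:
  assumes y: "y \<in> D" and z: "z \<in> nb y"
  shows "(\<Sum>v\<in>nb y \<inter> nb z. real (card (nb y \<inter> nb z \<inter> nb v))) 
     + (real q - 1) * (real q * real s + 1) * real q * (real s - 1)
     \<le> real (card (nb y \<inter> nb z)) * (real (card (nb y \<inter> nb z)) - 1)"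
proof -
  define T where "T = nb y \<inter> nb z"
  define R where "R = {w \<in> nb y. w \<noteq> z \<and> \<not> adj z w}"
  have zD: "z \<in> D" and yz: "adj y z" "adj z y" using z y adj_sym by (auto simp: nb_def)
  have cT: "real (card T) = 2 * real q * real s - real q"
  proof -
    have "real (card T + q) = real (2 * q * s)"
      using adjacent_codegree[OF y zD yz(1)] unfolding T_def nb_def by presburger
    then show ?thesis by simp
  qed
  have finT: "finite T" "finite R" by (auto simp: T_def R_def)
  have "nb y = insert z (T \<union> R)" using z yz by (auto simp: T_def R_def nb_def)
  moreover have "z \<notin> T \<union> R" "T \<inter> R = {}" using adj_irrefl zD by (auto simp: T_def R_def nb_def)
  ultimately have "card (nb y) = Suc (card T + card R)" using finT by (simp add: card_Un_disjoint)
  then have "real (q * s * (q + 1)) = 1 + real (card T) + real (card R)"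
    using valency[OF y] by (simp add: nb_def)
  then have cR: "real (card R) = (real q - 1) * (real q * real s + 1)"
    using cT by (simp add: algebra_simps)
  have low: "real q * (real s - 1) \<le> real (card (T \<inter> nb w))" if w: "w \<in> R" for w
  proof -
    have wD: "w \<in> D" "z \<noteq> w" "\<not> adj z w" "adj w y" using w y adj_sym by (auto simp: R_def nb_def)
    let ?C = "nb z \<inter> nb w"
    let ?B = "{v \<in> D. adj z v \<and> adj w v \<and> v \<noteq> y \<and> \<not> adj y v}"
    have "card ?B < q" by (rule few_nonneighbours) (use wD yz y zD in auto)
    moreover have "?C \<subseteq> insert y ((T \<inter> nb w) \<union> ?B)" by (auto simp: T_def nb_def)
    then have "card ?C \<le> card (insert y ((T \<inter> nb w) \<union> ?B))"
      by (rule card_mono[rotated]) (use finT finite_D in auto)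
    moreover have "card (insert y ((T \<inter> nb w) \<union> ?B)) \<le> Suc (card ((T \<inter> nb w) \<union> ?B))"
      using finT finite_D by (simp add: card_insert_if)
    moreover have "card ((T \<inter> nb w) \<union> ?B) \<le> card (T \<inter> nb w) + card ?B" by (rule card_Un_le)
    moreover have "card ?C = q * s" using nonadjacent_codegree[OF zD wD(1,2,3)] by (simp add: nb_def)
    ultimately have "q * s \<le> card (T \<inter> nb w) + q" by linarith
    then have "real (q * s) \<le> real (card (T \<inter> nb w) + q)" using of_nat_le_iff by blast
    then show ?thesis by (simp add: algebra_simps)
  qed
  have split: "real (card (T \<inter> nb v)) + real (card (R \<inter> nb v)) = real (card T) - 1" if v: "v \<in> T" for v
  proof -
    have vD: "v \<in> D" "adj y v" "adj v z" using v zD adj_sym by (auto simp: T_def nb_def)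
    have "nb y \<inter> nb v = insert z ((T \<inter> nb v) \<union> (R \<inter> nb v))"
      using z vD by (auto simp: T_def R_def nb_def)
    moreover have "z \<notin> T \<union> R" "T \<inter> R = {}" using adj_irrefl zD by (auto simp: T_def R_def nb_def)
    moreover have "card ((T \<inter> nb v) \<union> (R \<inter> nb v)) = card (T \<inter> nb v) + card (R \<inter> nb v)"
      by (rule card_Un_disjoint) (use finT calculation in auto)
    ultimately have "card (nb y \<inter> nb v) = Suc (card (T \<inter> nb v) + card (R \<inter> nb v))"
      using finT by simp
    moreover have "card (nb y \<inter> nb v) + q = 2 * q * s"
      using adjacent_codegree[OF y vD(1,2)] by (simp add: nb_def)
    ultimately have "real (Suc (card (T \<inter> nb v) + card (R \<inter> nb v)) + q) = real (2 * q * s)" by presburger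
    then show ?thesis using cT by simp
  qed
  have "real (card R) * (real q * (real s - 1)) \<le> (\<Sum>w\<in>R. real (card (T \<inter> nb w)))"
    using sum_bounded_below[of R "real q * (real s - 1)" "\<lambda>w. real (card (T \<inter> nb w))"] low by simp
  also have "\<dots> = (\<Sum>w\<in>R. \<Sum>v\<in>T. of_bool (adj w v))"
    using finT by (intro sum.cong refl) (auto simp: sum_of_bool_card T_def nb_def intro!: arg_cong[where f = card])
  also have "\<dots> = (\<Sum>v\<in>T. \<Sum>w\<in>R. of_bool (adj w v))" by (rule sum.swap)
  also have "\<dots> = (\<Sum>v\<in>T. real (card (R \<inter> nb v)))"
  proof (intro sum.cong refl)
    fix v assume "v \<in> T"
    then have "{w \<in> R. adj w v} = R \<inter> nb v" using adj_sym by (auto simp: T_def R_def nb_def)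
    then show "(\<Sum>w\<in>R. of_bool (adj w v)) = real (card (R \<inter> nb v))" using finT by (simp only: sum_of_bool_card)
  qed
  also have "\<dots> = (\<Sum>v\<in>T. (real (card T) - 1) - real (card (T \<inter> nb v)))"
    using split by (intro sum.cong refl) (simp add: algebra_simps)
  also have "\<dots> = real (card T) * (real (card T) - 1) - (\<Sum>v\<in>T. real (card (T \<inter> nb v)))"
    by (simp add: sum_subtractf)
  finally show ?thesis unfolding cR T_def[symmetric] by (simp add: algebra_simps)
qed

text \<open>
  The two estimates for the number of edges among the common neighbours of \<open>y\<close> and \<open>z\<close> differ by a
  positive multiple of \<open>q - (q - 2)s\<close>.
\<close>

theorem q_minus_two_bound: "(real q - 2) * real s \<le> real q"
proof -
  have "D \<noteq> {}" using card_D q_ge_2 by auto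
  then obtain y where y: "y \<in> D" by blast
  have "card (nb y) \<noteq> 0" using valency[OF y] q_ge_2 s_ge_1 by (simp add: nb_def)
  then obtain z where z: "z \<in> nb y" by fastforce
  define N where "N = real (card (nb y \<inter> nb z))"
  define S where "S = (\<Sum>v\<in>nb y \<inter> nb z. real (card (nb y \<inter> nb z \<inter> nb v)))"
  have "card (nb y \<inter> nb z) + q = 2 * q * s"
    using adjacent_codegree[of y z] y z by (simp add: nb_def)
  then have "real (card (nb y \<inter> nb z) + q) = real (2 * q * s)" by presburger
  then have N: "N = real q * (2 * real s - 1)" by (simp add: N_def algebra_simps)
  have l: "3 * N\<^sup>2 \<le> (real q + 2) * (real q * N + S)"
    using edge_link_lower[OF y z] by (simp add: N_def S_def)
  have "S \<le> N * (N - 1) - (real q - 1) * (real q * real s + 1) * real q * (real s - 1)"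
    using edge_link_upper[OF y z] by (simp add: N_def S_def)
  then have "(real q + 2) * (real q * N + S) \<le> (real q + 2) * (real q * N + 
     (N * (N - 1) - (real q - 1) * (real q * real s + 1) * real q * (real s - 1)))"
    by (intro mult_left_mono) auto
  with l have "0 \<le> (real q + 2) * (real q * N + 
     (N * (N - 1) - (real q - 1) * (real q * real s + 1) * real q * (real s - 1))) - 3 * N\<^sup>2" by linarith
  also have "\<dots> = real q * (real q - 1) * (real q * real s + 1) * (real q - (real q - 2) * real s)"
    unfolding N power2_eq_square by algebra
  finally have "0 \<le> real q * (real q - 1) * (real q * real s + 1) * (real q - (real q - 2) * real s)" .
  moreover have "0 < real q * (real q - 1) * (real q * real s + 1)" using q_ge_2 by (intro mult_pos_pos add_nonneg_pos) auto
  ultimately have "0 \<le> real q - (real q - 2) * real s" by (meson linorder_not_le mult_pos_neg)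
  then show ?thesis by simp
qed

text \<open>
  For \<open>q = 2\<close> non-adjacency is a perfect matching on the common neighbours of any two non-adjacent
  vertices. Fix non-adjacent \<open>w\<close>, \<open>w'\<close>, let \<open>C\<close> be the set of their common neighbours and \<open>W\<close> the set of
  the other neighbours of \<open>w\<close>. The \<open>4s\<close> vertices of \<open>W\<close> are described by their traces on \<open>C\<close>, which
  contain exactly one vertex of each matched pair; for \<open>s \<ge> 3\<close> two of them are non-adjacent exactly
  when their traces are complementary.
\<close>

lemma q_two_bound:
  assumes q: "q = 2"
    and one_nonneighbour: "\<And>x w y. x \<in> D \<Longrightarrow> w \<in> D \<Longrightarrow> x \<noteq> w \<Longrightarrow> \<not> adj x w \<Longrightarrow>
      y \<in> nb x \<inter> nb w \<Longrightarrow> card {z \<in> nb x \<inter> nb w. z \<noteq> y \<and> \<not> adj y z} = 1"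
  shows "s \<le> 2"
proof (rule ccontr)
  assume "\<not> s \<le> 2"
  then have s: "3 \<le> s" by simp
  have nb_iff: "y \<in> nb x \<longleftrightarrow> x \<in> nb y" if "x \<in> D" "y \<in> D" for x y
    using that adj_sym by (auto simp: nb_def)
  have irr: "x \<notin> nb x" if "x \<in> D" for x using that adj_irrefl by (auto simp: nb_def)
  have nbD: "y \<in> D" if "y \<in> nb x" for x y using that nb_subset by blast
  have cnb: "card (nb x) = 6 * s" if "x \<in> D" for x using valency[OF that] q by (simp add: nb_def)
  have cadj: "card (nb x \<inter> nb y) = 4 * s - 2" if "x \<in> D" "y \<in> nb x" for x y
    using adjacent_codegree[of x y] that q by (simp add: nb_def)
  have cnon: "card (nb x \<inter> nb y) = 2 * s" if "x \<in> D" "y \<in> D" "x \<noteq> y" "y \<notin> nb x" for x y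
    using nonadjacent_codegree[of x y] that q by (simp add: nb_def)
  have single: "\<exists>t. {z \<in> nb x \<inter> nb w. z \<noteq> y \<and> z \<notin> nb y} = {t}"
    if "x \<in> D" "w \<in> D" "x \<noteq> w" "w \<notin> nb x" "y \<in> nb x \<inter> nb w" for x w y
  proof -
    have "card {z \<in> nb x \<inter> nb w. z \<noteq> y \<and> \<not> adj y z} = 1"
      by (rule one_nonneighbour) (use that in \<open>auto simp: nb_def\<close>)
    moreover have "{z \<in> nb x \<inter> nb w. z \<noteq> y \<and> \<not> adj y z} = {z \<in> nb x \<inter> nb w. z \<noteq> y \<and> z \<notin> nb y}"
      by (auto simp: nb_def)
    ultimately show ?thesis by (simp add: card_1_singleton_iff)
  qed
  have uniq: "z = z'" if *: "x \<in> D" "w \<in> D" "x \<noteq> w" "w \<notin> nb x" "y \<in> nb x \<inter> nb w" and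
    zz: "z \<in> nb x \<inter> nb w" "z \<noteq> y" "z \<notin> nb y" "z' \<in> nb x \<inter> nb w" "z' \<noteq> y" "z' \<notin> nb y" for x w y z z'
  proof -
    obtain t where t: "{z \<in> nb x \<inter> nb w. z \<noteq> y \<and> z \<notin> nb y} = {t}" using single[OF *] by blast
    have "z \<in> {z \<in> nb x \<inter> nb w. z \<noteq> y \<and> z \<notin> nb y}" "z' \<in> {z \<in> nb x \<inter> nb w. z \<noteq> y \<and> z \<notin> nb y}"
      using zz by simp_all
    then show ?thesis unfolding t by simp
  qed
  have exis: "\<exists>z. z \<in> nb x \<inter> nb w \<and> z \<noteq> y \<and> z \<notin> nb y"
    if *: "x \<in> D" "w \<in> D" "x \<noteq> w" "w \<notin> nb x" "y \<in> nb x \<inter> nb w" for x w y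
    using single[OF *] by blast
  \<comment> \<open>Two non-adjacent neighbours of \<open>w\<close> have \<open>2s - 2\<close> common neighbours adjacent to \<open>w\<close>, so by inclusion
    and exclusion they and their neighbours already exhaust the \<open>6s\<close> neighbours of \<open>w\<close>.\<close>
  have claw_free: "c \<in> nb u \<or> c \<in> nb v"
    if w: "w \<in> D" and u: "u \<in> nb w" and v: "v \<in> nb w" and c: "c \<in> nb w"
      and uv: "u \<noteq> v" "v \<notin> nb u" and cu: "c \<noteq> u" "c \<noteq> v" for w u v c
  proof (rule ccontr)
    assume con: "\<not> (c \<in> nb u \<or> c \<in> nb v)"
    have D: "u \<in> D" "v \<in> D" "c \<in> D" using u v c nbD by blast+
    have wuv: "w \<in> nb u \<inter> nb v" using nb_iff D w u v by blast
    obtain t where t: "t \<in> nb u \<inter> nb v" "t \<noteq> w" "t \<notin> nb w" using exis[OF D(1,2) uv wuv] by blast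
    let ?I = "nb w \<inter> nb u \<inter> nb v"
    have "nb u \<inter> nb v = insert w (insert t ?I)"
    proof (intro equalityI subsetI)
      fix z assume z: "z \<in> nb u \<inter> nb v"
      show "z \<in> insert w (insert t ?I)"
      proof (cases "z = w \<or> z \<in> nb w")
        case False
        then have "t = z" using uniq[OF D(1,2) uv wuv t z] by blast
        then show ?thesis by simp
      qed (use z in auto)
    qed (use wuv t in auto)
    moreover have "w \<notin> insert t ?I" "t \<notin> ?I" using t irr[OF w] by auto
    ultimately have I: "card ?I + 2 = 2 * s" using cnon[OF D(1,2) uv] by simp
    have "card ((nb w \<inter> nb u) \<union> (nb w \<inter> nb v)) + card ((nb w \<inter> nb u) \<inter> (nb w \<inter> nb v))
        = card (nb w \<inter> nb u) + card (nb w \<inter> nb v)" by (rule card_Un_Int[symmetric]) auto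
    moreover have "(nb w \<inter> nb u) \<inter> (nb w \<inter> nb v) = ?I" by auto
    ultimately have "card ((nb w \<inter> nb u) \<union> (nb w \<inter> nb v)) + 2 = 6 * s"
      using I cadj[OF w u] cadj[OF w v] s by simp
    moreover have "u \<notin> insert v (insert c ((nb w \<inter> nb u) \<union> (nb w \<inter> nb v)))"
        "v \<notin> insert c ((nb w \<inter> nb u) \<union> (nb w \<inter> nb v))" "c \<notin> (nb w \<inter> nb u) \<union> (nb w \<inter> nb v)"
      using irr[OF D(1)] irr[OF D(2)] uv cu con nb_iff[OF D(1,2)] by auto
    ultimately have "card (insert u (insert v (insert c ((nb w \<inter> nb u) \<union> (nb w \<inter> nb v))))) = 6 * s + 1"
      by simp
    moreover have "card (insert u (insert v (insert c ((nb w \<inter> nb u) \<union> (nb w \<inter> nb v))))) \<le> card (nb w)"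
      by (rule card_mono) (use u v c in auto)
    ultimately show False using cnb[OF w] by simp
  qed
  have "D \<noteq> {}" using card_D q by auto
  then obtain w where w: "w \<in> D" by blast
  have "\<not> D \<subseteq> insert w (nb w)"
  proof
    assume "D \<subseteq> insert w (nb w)"
    then have "card D \<le> card (insert w (nb w))" by (intro card_mono) auto
    also have "\<dots> \<le> Suc (card (nb w))" by (simp add: card_insert_if)
    finally show False using cnb[OF w] card_D q by simp
  qed
  then obtain w' where w': "w' \<in> D" "w' \<noteq> w" "w' \<notin> nb w" by auto
  define C where "C = nb w \<inter> nb w'"
  define W where "W = nb w - nb w'"
  define T where "T c = C \<inter> nb c" for c
  define M where "M c = {c' \<in> W. c' \<noteq> c \<and> c' \<notin> nb c}" for c
  have fin: "finite C" "finite W" "finite (T c)" "finite (M c)" for c by (auto simp: C_def W_def T_def M_def)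
  have CD: "y \<in> D" if "y \<in> C" for y using that nbD by (simp add: C_def) blast
  have WD: "c \<in> D" "c \<in> nb w" "c \<notin> C" if "c \<in> W" for c using that nbD[of c w] by (auto simp: C_def W_def)
  have cC: "card C = 2 * s" using cnon[of w w'] w w' by (auto simp: C_def)
  have "nb w = C \<union> W" "C \<inter> W = {}" by (auto simp: C_def W_def)
  then have "card (nb w) = card C + card W" using fin by (simp add: card_Un_disjoint)
  then have cW: "card W = 4 * s" using cC cnb[OF w] by simp
  have Cuniq: "z = z'" if "y \<in> C" "z \<in> C" "z \<noteq> y" "z \<notin> nb y" "z' \<in> C" "z' \<noteq> y" "z' \<notin> nb y" for y z z'
    using uniq[of w w' y z z'] that w w' by (auto simp: C_def)
  have "\<exists>z. z \<in> C \<and> z \<noteq> y \<and> z \<notin> nb y" if "y \<in> C" for y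
    using exis[of w w' y] that w w' by (auto simp: C_def)
  \<comment> \<open>The matching of \<open>C\<close> that pairs each vertex with its non-neighbour.\<close>
  then obtain b where b: "b y \<in> C" "b y \<noteq> y" "b y \<notin> nb y" if "y \<in> C" for y by metis
  have bb: "b (b y) = y" if "y \<in> C" for y
    using Cuniq[of "b y" "b (b y)" y] b[OF that] b[of "b y"] that nb_iff CD by metis
  \<comment> \<open>A vertex of \<open>W\<close> adjacent to both vertices of a pair would, besides \<open>w\<close>, be a second non-neighbour
    of \<open>w'\<close> among the common neighbours of that pair; one adjacent to neither would give a claw at \<open>w\<close>.\<close>
  have one_of_pair: "b y \<in> T c \<longleftrightarrow> y \<notin> T c" if c: "c \<in> W" and y: "y \<in> C" for c y
  proof -
    have D: "y \<in> D" "b y \<in> D" "c \<in> D" using CD WD b y c by auto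
    have "y \<in> nb w" "b y \<in> nb w" using y b[OF y] by (auto simp: C_def)
    then have "c \<in> nb y \<or> c \<in> nb (b y)"
      using claw_free[OF w, of y "b y" c] b[OF y] WD[OF c] y by auto
    moreover have "\<not> (c \<in> nb y \<and> c \<in> nb (b y))"
    proof
      assume "c \<in> nb y \<and> c \<in> nb (b y)"
      moreover have "w' \<in> nb y \<inter> nb (b y)" "w \<in> nb y \<inter> nb (b y)"
        using y b[OF y] nb_iff D w w' by (auto simp: C_def)
      moreover have "w \<notin> nb w'" "w \<noteq> w'" "c \<notin> nb w'" "c \<noteq> w'" "w \<noteq> c"
        using w w' nb_iff[of w w'] c irr[OF w] by (auto simp: W_def)
      ultimately have "w = c" using uniq[of y "b y" w' w c] D b[OF y] y by auto
      with \<open>w \<noteq> c\<close> show False by blast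
    qed
    ultimately show ?thesis using nb_iff D y b[OF y] by (auto simp: T_def)
  qed
  have cT: "card (T c) = s" if c: "c \<in> W" for c
  proof -
    have inj: "inj_on b C" by (metis bb inj_onI)
    have TC: "T c \<subseteq> C" by (auto simp: T_def)
    have "b ` T c \<subseteq> C - T c" "b ` (C - T c) \<subseteq> T c"
      using one_of_pair[OF c] b TC by auto
    then have "card (T c) \<le> card (C - T c)" "card (C - T c) \<le> card (T c)"
      using inj TC fin by (meson card_inj_on_le inj_on_subset Diff_subset finite_Diff)+
    moreover have "card (C - T c) = 2 * s - card (T c)" using TC fin cC by (simp add: card_Diff_subset)
    moreover have "card (T c) \<le> 2 * s" using TC fin cC card_mono by metis
    ultimately show ?thesis by linarith
  qed
  \<comment> \<open>Count the neighbours of \<open>w\<close> by their relation to \<open>c\<close>.\<close>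
  have cM: "card (M c) = s + 1" if c: "c \<in> W" for c
  proof -
    let ?A = "nb w \<inter> nb c" and ?B = "C - T c"
    have "card (?A \<union> (M c \<union> ?B)) = card ?A + card (M c \<union> ?B)"
      by (rule card_Un_disjoint) (use fin in \<open>auto simp: M_def T_def W_def C_def\<close>)
    moreover have "card (M c \<union> ?B) = card (M c) + card ?B"
      by (rule card_Un_disjoint) (use fin in \<open>auto simp: M_def T_def W_def C_def\<close>)
    moreover have "c \<notin> ?A \<union> (M c \<union> ?B)" using irr WD[OF c] by (auto simp: M_def)
    then have "card (insert c (?A \<union> (M c \<union> ?B))) = Suc (card (?A \<union> (M c \<union> ?B)))"
      using fin by simp
    moreover have "nb w = insert c (?A \<union> (M c \<union> ?B))"
      using WD[OF c] by (auto simp: M_def T_def C_def W_def)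
    then have "card (nb w) = card (insert c (?A \<union> (M c \<union> ?B)))" by (rule arg_cong)
    ultimately have "card (nb w) = Suc (card ?A + (card (M c) + card ?B))" by linarith
    moreover have "card ?B = s" using cT[OF c] cC fin by (simp add: card_Diff_subset T_def)
    ultimately show ?thesis using cnb[OF w] cadj[OF w WD(2)[OF c]] s by simp
  qed
  have compl: "T c' = C - T c" if c: "c \<in> W" and c': "c' \<in> M c" for c c'
  proof -
    have c'W: "c' \<in> W" "c' \<noteq> c" "c' \<notin> nb c" using c' by (auto simp: M_def)
    have claw: "y \<in> T c \<or> y \<in> T c'" if y: "y \<in> C" for y
    proof -
      have "y \<in> nb w" "y \<noteq> c" "y \<noteq> c'" using y WD(3)[OF c] WD(3)[OF c'W(1)] by (auto simp: C_def)
      then show ?thesis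
        using claw_free[OF w, of c c' y] WD[OF c] WD[OF c'W(1)] c'W y by (auto simp: T_def)
    qed
    moreover have "\<not> (y \<in> T c \<and> y \<in> T c')" if y: "y \<in> C" for y
      using claw[of "b y"] b[OF y] one_of_pair[OF c y] one_of_pair[OF c'W(1) y] by blast
    ultimately show ?thesis by (auto simp: T_def)
  qed
  \<comment> \<open>If \<open>c\<close> and \<open>c'\<close> were adjacent with complementary traces, take \<open>y0\<close> in the trace of \<open>c\<close> and its partner
    \<open>v\<close>. The other \<open>s - 1 \<ge> 2\<close> vertices of the trace of \<open>c\<close> are common neighbours of \<open>c\<close> and \<open>v\<close> that are
    not adjacent to the common neighbour \<open>c'\<close>, but only one such vertex is allowed.\<close>
  have not_compl: "T c' \<noteq> C - T c" if c: "c \<in> W" and c': "c' \<in> W" "c' \<in> nb c" for c c'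
  proof
    assume eq: "T c' = C - T c"
    have "T c \<noteq> {}" using cT[OF c] s by auto
    then obtain y0 where y0: "y0 \<in> T c" by blast
    then have y0C: "y0 \<in> C" by (simp add: T_def)
    define v where "v = b y0"
    have v: "v \<in> C" "v \<notin> T c" "v \<in> T c'" "v \<in> D"
      using b[OF y0C] one_of_pair[OF c y0C] y0 eq CD by (auto simp: v_def)
    have cv: "c \<in> D" "v \<in> D" "c \<noteq> v" "v \<notin> nb c" using v WD[OF c] by (auto simp: T_def)
    have c'm: "c' \<in> nb c \<inter> nb v" using c' v nb_iff WD(1)[OF c'(1)] by (auto simp: T_def)
    have "y = z" if "y \<in> T c - {y0}" "z \<in> T c - {y0}" for y z
    proof -
      have *: "u \<in> nb c \<inter> nb v \<and> u \<noteq> c' \<and> u \<notin> nb c'" if u: "u \<in> T c - {y0}" for u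
      proof -
        have "u \<in> C" "u \<noteq> v" using u v by (auto simp: T_def)
        have "u \<in> nb v"
        proof (rule ccontr)
          assume "u \<notin> nb v"
          then have "u = y0" using Cuniq[of v u y0] v \<open>u \<in> C\<close> \<open>u \<noteq> v\<close> y0C b[OF y0C] nb_iff CD 
            by (metis v_def)
          then show False using u by blast
        qed
        then show ?thesis using u eq WD(3)[OF c'(1)] by (auto simp: T_def)
      qed
      show ?thesis using uniq[OF cv c'm, of y z] *[OF that(1)] *[OF that(2)] by blast
    qed
    then have "card (T c - {y0}) \<le> Suc 0" using fin by (simp add: card_le_Suc0_iff_eq)
    then show False using cT[OF c] y0 fin s by simp
  qed
  have M_iff: "c' \<in> M c \<longleftrightarrow> T c' = C - T c" if c: "c \<in> W" "c' \<in> W" for c c'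
  proof -
    have "T c \<noteq> {}" using cT[OF c(1)] s by auto
    then have "T c \<noteq> C - T c" by blast
    then show ?thesis using compl[OF c(1)] not_compl[OF c] c(2) by (auto simp: M_def)
  qed
  have MW: "M c \<subseteq> W" for c by (auto simp: M_def)
  have ne: "M c \<noteq> {}" if "c \<in> W" for c using cM[OF that] by auto
  \<comment> \<open>The classes of \<open>c0\<close> and \<open>c1\<close> carry complementary traces and do not cover \<open>W\<close>; a vertex outside them
    gives a second such couple of classes.\<close>
  have "W \<noteq> {}" using cW s by auto
  then obtain c0 where c0: "c0 \<in> W" by blast
  obtain c1 where c1: "c1 \<in> M c0" using ne[OF c0] by blast
  have c1W: "c1 \<in> W" using c1 MW by blast
  have "card (M c0 \<union> M c1) \<le> card (M c0) + card (M c1)" by (rule card_Un_le)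
  then have "card (M c0 \<union> M c1) < card W" using cM[OF c0] cM[OF c1W] cW s by simp
  then have "\<not> W \<subseteq> M c0 \<union> M c1" using fin by (meson card_mono finite_UnI not_le)
  then obtain c2 where c2: "c2 \<in> W" "c2 \<notin> M c0" "c2 \<notin> M c1" by blast
  obtain c3 where c3: "c3 \<in> M c2" using ne[OF c2(1)] by blast
  have c3W: "c3 \<in> W" using c3 MW by blast
  have sub: "T c \<subseteq> C" for c by (auto simp: T_def)
  have "T c1 = C - T c0" "T c3 = C - T c2" using M_iff c0 c1 c1W c2 c3 c3W by auto
  moreover have "T c2 \<noteq> C - T c0" "T c2 \<noteq> C - T c1" using M_iff c0 c1W c2 by auto
  moreover have "M c = {c' \<in> W. T c' = C - T c}" if "c \<in> W" for c using M_iff[OF that] MW by blast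
  ultimately have "M c0 \<inter> M c1 = {}" "M c2 \<inter> M c3 = {}" "(M c0 \<union> M c1) \<inter> (M c2 \<union> M c3) = {}"
    using c0 c1W c2(1) c3W sub[of c0] sub[of c2] cT[OF c0] cT[OF c2(1)] s by auto
  then have "card ((M c0 \<union> M c1) \<union> (M c2 \<union> M c3)) = 4 * (s + 1)"
    using fin cM c0 c1W c2(1) c3W by (simp add: card_Un_disjoint)
  moreover have "card ((M c0 \<union> M c1) \<union> (M c2 \<union> M c3)) \<le> card W"
    by (rule card_mono) (use fin MW in auto)
  ultimately show False using cW by simp
qed

end

section \<open>Intersection numbers of antipodal covers of diameter four\<close>

text \<open>
  A distance-regular graph of diameter four that is an antipodal \<open>r\<close>-cover, given by its metric only.
  Adjacency is distance one, and \<open>a\<close>, \<open>b\<close>, \<open>c\<close> are the intersection numbers as functions of the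
  distance; their values beyond the diameter are arbitrary, except that the equation for \<open>b\<close> also
  covers distance four, where it says that \<open>b 4\<close> is zero.
\<close>

locale antipodal_drg =
  fixes V :: "'v set" and d :: "'v \<Rightarrow> 'v \<Rightarrow> nat" and a b c :: "nat \<Rightarrow> nat" and r :: nat
  assumes finite_V: "finite V"
    and d_zero: "\<And>x y. x \<in> V \<Longrightarrow> y \<in> V \<Longrightarrow> d x y = 0 \<longleftrightarrow> x = y"
    and d_sym: "\<And>x y. x \<in> V \<Longrightarrow> y \<in> V \<Longrightarrow> d x y = d y x"
    and d_tri: "\<And>x y z. x \<in> V \<Longrightarrow> y \<in> V \<Longrightarrow> z \<in> V \<Longrightarrow> d x z \<le> d x y + d y z"
    and d_step: "\<And>x y i. x \<in> V \<Longrightarrow> y \<in> V \<Longrightarrow> d x y = Suc i \<Longrightarrow> \<exists>z\<in>V. d x z = i \<and> d z y = 1"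
    and d_le: "\<And>x y. x \<in> V \<Longrightarrow> y \<in> V \<Longrightarrow> d x y \<le> 4"
    and d_far: "\<exists>x\<in>V. \<exists>y\<in>V. d x y = 4"
    and a_card: "\<And>x y. x \<in> V \<Longrightarrow> y \<in> V \<Longrightarrow> card {z \<in> V. d x z = d x y \<and> d y z = 1} = a (d x y)"
    and b_card: "\<And>x y. x \<in> V \<Longrightarrow> y \<in> V \<Longrightarrow>
      card {z \<in> V. d x z = Suc (d x y) \<and> d y z = 1} = b (d x y)"
    and c_card: "\<And>x y i. x \<in> V \<Longrightarrow> y \<in> V \<Longrightarrow> d x y = Suc i \<Longrightarrow>
      card {z \<in> V. d x z = i \<and> d y z = 1} = c (Suc i)"
    and antipodal: "\<And>x y z. x \<in> V \<Longrightarrow> y \<in> V \<Longrightarrow> z \<in> V \<Longrightarrow> d x y = 4 \<Longrightarrow> d x z = 4 \<Longrightarrow>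
      y = z \<or> d y z = 4"
    and class_size: "\<And>x. x \<in> V \<Longrightarrow> card {z \<in> V. d x z = 4} + 1 = r"
begin

definition nbrs :: "'v \<Rightarrow> 'v set" where "nbrs x = {y \<in> V. d x y = 1}"

definition sphere :: "'v \<Rightarrow> nat \<Rightarrow> 'v set" where "sphere x i = {y \<in> V. d x y = i}"

abbreviation "k \<equiv> b 0"

lemma finite_nbrs [simp]: "finite (nbrs x)" and finite_sphere [simp]: "finite (sphere x i)"
  using finite_V by (auto simp: nbrs_def sphere_def)

lemma fin_coll [simp]: "finite {z \<in> V. P z}" using finite_V by simp

lemma valency: "x \<in> V \<Longrightarrow> card (nbrs x) = k"
  using b_card[of x x] d_zero[of x x] by (simp add: nbrs_def)

lemma d_near:
  assumes "x \<in> V" "y \<in> V" "z \<in> V" "d y z = 1"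
  shows "d x z = d x y - 1 \<and> d x y > 0 \<or> d x z = d x y \<or> d x z = Suc (d x y)"
  using d_tri[of x y z] d_tri[of x z y] d_sym[of y z] assms by auto

lemma pair_at: "i \<le> 4 \<Longrightarrow> \<exists>x\<in>V. \<exists>y\<in>V. d x y = i"
proof (induction "4 - i" arbitrary: i)
  case 0 then show ?case using d_far by auto
next
  case (Suc n)
  then have "n = 4 - Suc i" "Suc i \<le> 4" by auto
  from Suc(1)[OF this] obtain x y where "x \<in> V" "y \<in> V" "d x y = Suc i" by blast
  then show ?case using d_step by blast
qed

lemma a_0: "a 0 = 0"
proof -
  obtain x where x: "x \<in> V" using d_far by blast
  have "{z \<in> V. d x z = d x x \<and> d x z = 1} = {}" using d_zero[of x x] x by auto
  then have "card {z \<in> V. d x z = d x x \<and> d x z = 1} = 0" by (simp only: card.empty)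
  then show ?thesis unfolding a_card[OF x x] using d_zero[OF x x] by simp
qed

lemma c_1: "c 1 = 1"
proof -
  obtain x y where xy: "x \<in> V" "y \<in> V" "d x y = 1" using pair_at[of 1] by auto
  then have "{z \<in> V. d x z = 0 \<and> d y z = 1} = {x}" using d_zero d_sym by auto
  then show ?thesis using c_card[OF xy(1,2), of 0] xy(3) by simp
qed

lemma b_4: "b 4 = 0"
proof -
  obtain x y where xy: "x \<in> V" "y \<in> V" "d x y = 4" using d_far by blast
  then have "{z \<in> V. d x z = Suc (d x y) \<and> d y z = 1} = {}" using d_le[of x] by fastforce
  then have "card {z \<in> V. d x z = Suc (d x y) \<and> d y z = 1} = 0" by (simp only: card.empty)
  then have "b (d x y) = 0" unfolding b_card[OF xy(1,2)] .
  then show ?thesis unfolding xy(3) .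
qed

lemma row_sum:
  assumes "Suc i \<le> 4" shows "c (Suc i) + a (Suc i) + b (Suc i) = k"
proof -
  obtain x y where xy: "x \<in> V" "y \<in> V" "d x y = Suc i" using pair_at[OF assms] by blast
  let ?C = "{z \<in> V. d x z = i \<and> d y z = 1}" and ?A = "{z \<in> V. d x z = d x y \<and> d y z = 1}"
    and ?B = "{z \<in> V. d x z = Suc (d x y) \<and> d y z = 1}"
  have "nbrs y = ?C \<union> (?A \<union> ?B)" using d_near[OF xy(1,2)] xy(3) by (fastforce simp: nbrs_def)
  moreover have "card (?C \<union> (?A \<union> ?B)) = card ?C + card (?A \<union> ?B)"
    by (rule card_Un_disjoint) (use xy in auto)
  moreover have "card (?A \<union> ?B) = card ?A + card ?B" by (rule card_Un_disjoint) auto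
  ultimately show ?thesis
    using valency[OF xy(2)] a_card[OF xy(1,2)] b_card[OF xy(1,2)] c_card[OF xy] xy(3) by simp
qed

lemma c_pos: "i < 4 \<Longrightarrow> 0 < c (Suc i)"
proof -
  assume "i < 4"
  then obtain x y where xy: "x \<in> V" "y \<in> V" "d x y = Suc i" using pair_at[of "Suc i"] by auto
  obtain z where "z \<in> V" "d x z = i" "d z y = 1" using d_step[OF xy] by blast
  then have "{z \<in> V. d x z = i \<and> d y z = 1} \<noteq> {}" using d_sym xy by auto
  then have "card {z \<in> V. d x z = i \<and> d y z = 1} > 0" by (simp add: card_gt_0_iff)
  then show ?thesis using c_card[OF xy] by simp
qed

lemma b_pos: "i < 4 \<Longrightarrow> 0 < b i"
proof -
  assume "i < 4"
  then obtain x y where xy: "x \<in> V" "y \<in> V" "d x y = Suc i" using pair_at[of "Suc i"] by auto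
  obtain z where z: "z \<in> V" "d x z = i" "d z y = 1" using d_step[OF xy] by blast
  then have "{y \<in> V. d x y = Suc (d x z) \<and> d z y = 1} \<noteq> {}" using xy by auto
  then have "card {y \<in> V. d x y = Suc (d x z) \<and> d z y = 1} > 0" by (simp add: card_gt_0_iff)
  then show ?thesis using b_card[OF xy(1) z(1)] z by simp
qed

lemma r_ge_2: "2 \<le> r"
proof -
  obtain x y where xy: "x \<in> V" "y \<in> V" "d x y = 4" using d_far by blast
  then have "card {z \<in> V. d x z = 4} > 0" by (auto simp: card_gt_0_iff)
  then show ?thesis using class_size[OF xy(1)] by simp
qed

text \<open>
  Vertices of one antipodal class that are closer than the diameter coincide. All properties of the
  intersection array that are special to antipodal covers come from this.
\<close>

lemma antipodes_far:
  assumes "x \<in> V" "u \<in> V" "w \<in> V" "d x u = 4" "d x w = 4" "d u w < 4" shows "u = w"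
  using antipodal[OF assms(1-5)] assms(6) by auto

lemma c_4: "c 4 = k" and a_4: "a 4 = 0"
proof -
  obtain x y where xy: "x \<in> V" "y \<in> V" "d x y = 4" using d_far by blast
  have "{z \<in> V. d x z = d x y \<and> d y z = 1} = {}" 
    using antipodes_far[OF xy(1,2) _ xy(3)] xy d_zero by fastforce
  then have "card {z \<in> V. d x z = d x y \<and> d y z = 1} = 0" by (simp only: card.empty)
  then have "a (d x y) = 0" unfolding a_card[OF xy(1,2)] .
  then show "a 4 = 0" unfolding xy(3) .
  then show "c 4 = k" using row_sum[of 3] b_4 by (simp add: numeral_eq_Suc)
qed

lemma b_3: "b 3 = 1"
proof -
  obtain x y where xy: "x \<in> V" "y \<in> V" "d x y = 3" using pair_at[of 3] by auto
  have "z = z'" if "z \<in> V" "d x z = 4" "d y z = 1" "z' \<in> V" "d x z' = 4" "d y z' = 1" for z z'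
  proof (rule antipodes_far[OF xy(1)])
    show "d z z' < 4" using d_tri[of z y z'] d_sym[of y z] that xy by simp
  qed (use that in auto)
  then have "card {z \<in> V. d x z = Suc (d x y) \<and> d y z = 1} \<le> Suc 0"
    using xy by (subst card_le_Suc0_iff_eq) auto
  then show ?thesis using b_card[OF xy(1,2)] xy(3) b_pos[of 3] by simp
qed

lemma antipode_of_third:
  assumes "x \<in> V" "y \<in> V" "d x y = 3"
  obtains u where "u \<in> V" "d x u = 4" "d y u = 1"
proof -
  have "card {z \<in> V. d x z = Suc (d x y) \<and> d y z = 1} \<noteq> 0"
    using b_card[OF assms(1,2)] b_3 assms(3) by simp
  then obtain u where "u \<in> {z \<in> V. d x z = Suc (d x y) \<and> d y z = 1}"
    by (metis card.empty ex_in_conv)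
  then show ?thesis using that assms by auto
qed

text \<open>
  Let \<open>u\<close> be the vertex antipodal to \<open>x\<close> that is adjacent to \<open>y\<close>. Seen from \<open>u\<close>, the vertex \<open>y\<close> is at
  distance one, and a neighbour \<open>z\<close> of \<open>y\<close> has distance two from \<open>x\<close> if and only if it has distance
  two from \<open>u\<close>: if its distance from \<open>x\<close> were three or four, it would be adjacent or equal to an
  antipode of \<open>x\<close>, which can only be \<open>u\<close>.
\<close>

lemma c_3: "c 3 = b 1" and a_3: "a 3 = a 1"
proof -
  obtain x y where xy: "x \<in> V" "y \<in> V" "d x y = 3" using pair_at[of 3] by auto
  obtain u where u: "u \<in> V" "d x u = 4" "d y u = 1" using antipode_of_third[OF xy] .
  have uy: "d u y = 1" using u xy d_sym by simp
  have "d x z = 2 \<longleftrightarrow> d u z = 2" if z: "z \<in> V" "d y z = 1" for z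
  proof
    assume "d x z = 2"
    then show "d u z = 2" using d_tri[of x z u] d_tri[of u y z] d_sym[of u z] z u xy uy by simp
  next
    assume uz: "d u z = 2"
    have "d x z \<noteq> 4"
      using antipodes_far[OF xy(1) u(1) z(1) u(2)] uz d_zero[OF u(1) u(1)] by auto
    moreover have "d x z \<noteq> 3"
    proof
      assume "d x z = 3"
      then obtain t where t: "t \<in> V" "d x t = 4" "d z t = 1" using antipode_of_third xy z by metis
      have "d u t < 4" using d_tri[of u z t] uz t u z by simp
      then have "u = t" using antipodes_far[OF xy(1) u(1) t(1) u(2) t(2)] by blast
      then show False using t uz z u d_sym by simp
    qed
    ultimately show "d x z = 2" using d_near[OF xy(1,2) z] xy by auto
  qed
  then have "{z \<in> V. d x z = 2 \<and> d y z = 1} = {z \<in> V. d u z = Suc (d u y) \<and> d y z = 1}"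
    using uy by auto
  moreover have "card {z \<in> V. d x z = 2 \<and> d y z = 1} = c (Suc 2)" using c_card[OF xy(1,2)] xy(3) by simp
  ultimately show "c 3 = b 1" using b_card[OF u(1) xy(2)] uy by (simp add: numeral_eq_Suc)
  then show "a 3 = a 1" using row_sum[of 0] row_sum[of 2] b_3 c_1 by (simp add: numeral_eq_Suc)
qed

lemma antipode_of_second:
  assumes "x \<in> V" "y \<in> V" "u \<in> V" "d x y = 2" "d x u = 4"
  shows "d u y = 2"
proof -
  have "d u y \<noteq> 4"
    using antipodal[of u x y] assms d_sym[of x u] d_zero[of x y] by auto
  moreover have "d u y \<noteq> 3"
  proof
    assume "d u y = 3"
    then obtain t where t: "t \<in> V" "d u t = 4" "d y t = 1" using antipode_of_third assms by metis
    have "d x t < 4" using d_tri[of x y t] t assms by simp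
    then have "x = t" using antipodes_far[of u x t] assms t d_sym[of x u] by auto
    then show False using t assms d_sym[of x y] by simp
  qed
  moreover have "2 \<le> d u y" using d_tri[of x y u] d_sym[of u y] assms by simp
  moreover have "d u y \<le> 4" using d_le assms by blast
  ultimately show ?thesis by linarith
qed

text \<open>
  The neighbours of \<open>y\<close> at distance three from \<open>x\<close> are the neighbours that \<open>y\<close> shares with one of the
  \<open>r - 1\<close> antipodes of \<open>x\<close>, and all these antipodes are at distance two from \<open>y\<close>.
\<close>

lemma b_2: "b 2 = (r - 1) * c 2"
proof -
  obtain x y where xy: "x \<in> V" "y \<in> V" "d x y = 2" using pair_at[of 2] by auto
  let ?U = "{u \<in> V. d x u = 4}"
  let ?B = "\<lambda>u. {z \<in> V. d u z = 1 \<and> d y z = 1}"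
  have "{z \<in> V. d x z = Suc (d x y) \<and> d y z = 1} = (\<Union>u\<in>?U. ?B u)"
  proof (intro equalityI subsetI)
    fix z assume "z \<in> {z \<in> V. d x z = Suc (d x y) \<and> d y z = 1}"
    then have z: "z \<in> V" "d x z = 3" "d y z = 1" using xy by auto
    obtain u where "u \<in> V" "d x u = 4" "d z u = 1" using antipode_of_third[OF xy(1) z(1,2)] .
    then show "z \<in> (\<Union>u\<in>?U. ?B u)" using z d_sym by auto
  next
    fix z assume "z \<in> (\<Union>u\<in>?U. ?B u)"
    then obtain u where u: "u \<in> V" "d x u = 4" "z \<in> V" "d u z = 1" "d y z = 1" by auto
    have "d x z = 3" using d_tri[of x z u] d_tri[of x y z] d_sym[of u z] u xy by simp
    then show "z \<in> {z \<in> V. d x z = Suc (d x y) \<and> d y z = 1}" using u xy by simp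
  qed
  moreover have "card (\<Union>u\<in>?U. ?B u) = (\<Sum>u\<in>?U. card (?B u))"
  proof (rule card_UN_disjoint)
    show "\<forall>u\<in>?U. \<forall>w\<in>?U. u \<noteq> w \<longrightarrow> ?B u \<inter> ?B w = {}"
    proof (intro ballI impI)
      fix u w assume uw: "u \<in> ?U" "w \<in> ?U" "u \<noteq> w"
      have "\<not> (z \<in> V \<and> d u z = 1 \<and> d w z = 1)" for z
        using d_tri[of u z w] d_sym[of w z] antipodes_far[of x u w] uw xy(1) by auto
      then show "?B u \<inter> ?B w = {}" by auto
    qed
  qed auto
  moreover have "card (?B u) = c 2" if "u \<in> ?U" for u
    using c_card[of u y 1] antipode_of_second[OF xy(1,2) _ xy(3)] that xy by (simp add: numeral_eq_Suc)
  moreover have "card ?U = r - 1" using class_size[OF xy(1)] by simp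
  ultimately have "card {z \<in> V. d x z = Suc (d x y) \<and> d y z = 1} = (r - 1) * c 2" by simp
  then show ?thesis using b_card[OF xy(1,2)] xy(3) by simp
qed

lemma a_2: "real (a 2) = real k - real r * real (c 2)"
proof -
  have "real (r - 1) = real r - 1" using r_ge_2 by simp
  moreover have "c 2 + a 2 + b 2 = k" using row_sum[of 1] by (simp add: numeral_eq_Suc)
  then have "real (c 2 + a 2 + b 2) = real k" by (rule arg_cong)
  ultimately show ?thesis using b_2 by (simp add: algebra_simps)
qed

lemma a_1: "real (a 1) = real k - real (b 1) - 1"
  using row_sum[of 0] c_1 by simp

section \<open>Eigenvalues and cosine sequences\<close>

definition eigfun :: "real \<Rightarrow> ('v \<Rightarrow> real) \<Rightarrow> bool" where
  "eigfun \<theta> f \<longleftrightarrow> (\<forall>x\<in>V. (\<Sum>y\<in>nbrs x. f y) = \<theta> * f x)"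

text \<open>
  Sum the eigenvalue equation over a sphere and count each vertex with the number of its neighbours
  on that sphere.
\<close>

lemma sphere_recurrence:
  assumes f: "eigfun \<theta> f" and x: "x \<in> V"
  shows "\<theta> * (\<Sum>y\<in>sphere x i. f y) =
    (if i = 0 then 0 else real (b (i - 1)) * (\<Sum>y\<in>sphere x (i - 1). f y))
    + real (a i) * (\<Sum>y\<in>sphere x i. f y) + real (c (Suc i)) * (\<Sum>y\<in>sphere x (Suc i). f y)"
proof -
  have filt: "(\<Sum>y\<in>V. if d x y = j then t * f y else 0) = t * (\<Sum>y\<in>sphere x j. f y)" for t j
    by (simp only: sphere_def sum.inter_filter[OF finite_V, symmetric] sum_distrib_left)
  have "\<theta> * (\<Sum>y\<in>sphere x i. f y) = (\<Sum>z\<in>sphere x i. \<Sum>y\<in>nbrs z. f y)"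
    using f by (simp add: eigfun_def sphere_def sum_distrib_left)
  also have "\<dots> = (\<Sum>z\<in>sphere x i. \<Sum>y\<in>V. if d z y = 1 then f y else 0)"
    by (simp only: nbrs_def sum.inter_filter[OF finite_V])
  also have "\<dots> = (\<Sum>y\<in>V. \<Sum>z\<in>sphere x i. if d z y = 1 then f y else 0)" by (rule sum.swap)
  also have "\<dots> = (\<Sum>y\<in>V. real (card {z \<in> V. d x z = i \<and> d y z = 1}) * f y)"
  proof (rule sum.cong[OF refl])
    fix y assume y: "y \<in> V"
    have "(\<Sum>z\<in>sphere x i. if d z y = 1 then f y else 0) = (\<Sum>z\<in>{z \<in> sphere x i. d z y = 1}. f y)"
      by (rule sum.inter_filter[symmetric]) simp
    also have "{z \<in> sphere x i. d z y = 1} = {z \<in> V. d x z = i \<and> d y z = 1}"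
      using d_sym y by (auto simp: sphere_def)
    finally show "(\<Sum>z\<in>sphere x i. if d z y = 1 then f y else 0)
        = real (card {z \<in> V. d x z = i \<and> d y z = 1}) * f y" by simp
  qed
  also have "\<dots> = (\<Sum>y\<in>V. (if d x y = i - 1 then (if i = 0 then 0 else real (b (i - 1))) * f y else 0)
      + (if d x y = i then real (a i) * f y else 0) + (if d x y = Suc i then real (c (Suc i)) * f y else 0))"
  proof (rule sum.cong[OF refl])
    fix y assume y: "y \<in> V"
    consider (up) "i = Suc (d x y)" | (same) "i = d x y" | (down) "d x y = Suc i" |
      (far) "i \<noteq> Suc (d x y)" "i \<noteq> d x y" "d x y \<noteq> Suc i" by blast
    then show "real (card {z \<in> V. d x z = i \<and> d y z = 1}) * f y =
      (if d x y = i - 1 then (if i = 0 then 0 else real (b (i - 1))) * f y else 0)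
      + (if d x y = i then real (a i) * f y else 0) + (if d x y = Suc i then real (c (Suc i)) * f y else 0)"
    proof cases
      case up then show ?thesis using b_card[OF x y] by simp
    next
      case same then show ?thesis using a_card[OF x y] by (cases "d x y") simp_all
    next
      case down then show ?thesis using c_card[OF x y down] by (cases i) simp_all
    next
      case far
      have "{z \<in> V. d x z = i \<and> d y z = 1} = {}"
      proof (rule equals0I)
        fix z assume "z \<in> {z \<in> V. d x z = i \<and> d y z = 1}"
        then show False using d_near[OF x y, of z] far by auto
      qed
      then have "card {z \<in> V. d x z = i \<and> d y z = 1} = 0" by (simp only: card.empty)
      then show ?thesis using far by auto
    qed
  qed
  finally show ?thesis unfolding sum.distrib filt by simp
qed

lemma sphere_0: "x \<in> V \<Longrightarrow> sphere x 0 = {x}"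
  using d_zero by (auto simp: sphere_def)

lemma sphere_5: "x \<in> V \<Longrightarrow> sphere x 5 = {}"
  using d_le[of x] by (fastforce simp: sphere_def)

text \<open>
  By the recurrence, the sum of an eigenfunction over a sphere is determined by its value at the
  centre, through a factor that depends on the eigenvalue and the radius only.
\<close>

lemma sphere_sum_scalar:
  assumes "i \<le> 4"
  shows "\<exists>t. \<forall>f x. eigfun \<theta> f \<and> x \<in> V \<longrightarrow> (\<Sum>y\<in>sphere x i. f y) = t * f x"
  using assms
proof (induction i rule: less_induct)
  case (less i)
  show ?case
  proof (cases i)
    case 0 then show ?thesis by (intro exI[of _ 1]) (simp add: sphere_0)
  next
    case (Suc j)
    have c: "c (Suc j) \<noteq> 0" using c_pos[of j] less(2) Suc by simp
    obtain t where t: "\<And>f x. eigfun \<theta> f \<Longrightarrow> x \<in> V \<Longrightarrow> (\<Sum>y\<in>sphere x j. f y) = t * f x"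
      using less(1)[of j] less(2) Suc by auto
    have "j - 1 < i" "j - 1 \<le> 4" using less(2) Suc by auto
    from less(1)[OF this] obtain u
      where u: "\<And>f x. eigfun \<theta> f \<Longrightarrow> x \<in> V \<Longrightarrow> (\<Sum>y\<in>sphere x (j - 1). f y) = u * f x" by blast
    show ?thesis
    proof (intro exI allI impI, elim conjE)
      fix f x assume fx: "eigfun \<theta> f" "x \<in> V"
      show "(\<Sum>y\<in>sphere x i. f y) =
        ((\<theta> - real (a j)) * t - (if j = 0 then 0 else real (b (j - 1)) * u)) / real (c (Suc j)) * f x"
        using sphere_recurrence[OF fx, of j] t[OF fx] u[OF fx] c Suc
        by (simp add: field_simps split: if_splits)
    qed
  qed
qed

text \<open>
  The roots of \<open>skew_poly\<close> belong to eigenfunctions that sum to zero over the antipodal classes, and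
  the roots of \<open>folded_poly\<close> to those that are constant on the classes and so come from the quotient.
\<close>

abbreviation "skew_poly x \<equiv> x\<^sup>2 - real (a 1) * x - real k"
abbreviation "folded_poly x \<equiv> skew_poly x + real r * real (c 2) * (x + 1)"

text \<open>
  Eliminate the sphere sums from the five instances of the recurrence; what remains is a polynomial
  equation of degree five, which splits into a linear and two quadratic factors.
\<close>

lemma eigenvalue_cases:
  assumes f: "eigfun \<theta> f" and x: "x \<in> V" and fx: "f x \<noteq> 0"
  shows "\<theta> = real k \<or> skew_poly \<theta> = 0 \<or> folded_poly \<theta> = 0"
proof -
  define F where "F i = (\<Sum>y\<in>sphere x i. f y)" for i
  note R = sphere_recurrence[OF f x, folded F_def]
  have F0: "F 0 = f x" using x by (simp add: F_def sphere_0)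
  have F5: "F 5 = 0" using x by (simp add: F_def sphere_5)
  have e0: "F 1 = \<theta> * F 0" using R[of 0] a_0 c_1 by simp
  have e1: "\<theta> * F 1 = real k * F 0 + real (a 1) * F 1 + real (c 2) * F 2"
    using R[of 1] by (simp add: numeral_eq_Suc)
  have e2: "\<theta> * F 2 = real (b 1) * F 1 + real (a 2) * F 2 + real (b 1) * F 3"
    using R[of 2] c_3 by (simp add: numeral_eq_Suc)
  have e3: "\<theta> * F 3 = real (b 2) * F 2 + real (a 1) * F 3 + real k * F 4"
    using R[of 3] c_4 a_3 by (simp add: numeral_eq_Suc)
  have e4: "\<theta> * F 4 = F 3"
    using R[of 4] F5 a_4 b_3 by (simp add: numeral_eq_Suc)
  have c2: "real (c 2) \<noteq> 0" using c_pos[of 1] by (simp add: numeral_eq_Suc)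
  have b2: "real (b 2) = (real r - 1) * real (c 2)" using b_2 r_ge_2 by simp
  have f2: "real (c 2) * F 2 = skew_poly \<theta> * F 0" using e1 e0 by (simp add: algebra_simps power2_eq_square)
  have "skew_poly \<theta> * F 3 = \<theta> * real (b 2) * F 2" using e3 e4 by algebra
  then have "skew_poly \<theta> * (F 3 - \<theta> * (real r - 1) * F 0) = 0" using f2 b2 c2 by algebra
  then consider "skew_poly \<theta> = 0" | "F 3 = \<theta> * (real r - 1) * F 0" by auto
  then show ?thesis
  proof cases
    case 2
    have "(\<theta> - real k) * folded_poly \<theta> * F 0 = 0"
      using e2 f2 2 e0 a_2 a_1 by algebra
    then show ?thesis using F0 fx by auto
  qed simp
qed

text \<open>
  The condition that \<open>\<sigma>\<close>, as a function of the distance from a vertex, is an eigenfunction for \<open>\<theta>\<close>,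
  normalised at that vertex. At \<open>i = 4\<close> the value \<open>\<sigma> 5\<close> is multiplied by \<open>b 4 = 0\<close>.
\<close>

definition cosines :: "real \<Rightarrow> (nat \<Rightarrow> real) \<Rightarrow> bool" where
  "cosines \<theta> \<sigma> \<longleftrightarrow> \<sigma> 0 = 1 \<and> (\<forall>i\<le>4. (if i = 0 then 0 else real (c i) * \<sigma> (i - 1))
     + real (a i) * \<sigma> i + real (b i) * \<sigma> (Suc i) = \<theta> * \<sigma> i)"

lemma all_le_4: "(\<forall>i\<le>4. P i) \<longleftrightarrow> P 0 \<and> P 1 \<and> P 2 \<and> P 3 \<and> P (4::nat)"
proof -
  have "{..4::nat} = {0,1,2,3,4}" by auto
  then show ?thesis by (metis (no_types, lifting) atMost_iff insert_iff empty_iff)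
qed

lemma k_pos: "0 < real k" and b1_pos: "0 < real (b 1)" and c2_pos: "0 < real (c 2)"
  using b_pos[of 0] b_pos[of 1] c_pos[of 1] by (simp_all add: numeral_eq_Suc)

lemma cosinesI:
  assumes "\<sigma> 0 = 1" and "real k * \<sigma> 1 = \<theta>"
    and "1 + real (a 1) * \<sigma> 1 + real (b 1) * \<sigma> 2 = \<theta> * \<sigma> 1"
    and "real (c 2) * \<sigma> 1 + real (a 2) * \<sigma> 2 + real (b 2) * \<sigma> 3 = \<theta> * \<sigma> 2"
    and "real (b 1) * \<sigma> 2 + real (a 1) * \<sigma> 3 + \<sigma> 4 = \<theta> * \<sigma> 3"
    and "real k * \<sigma> 3 = \<theta> * \<sigma> 4"
  shows "cosines \<theta> \<sigma>"
  unfolding cosines_def all_le_4 using assms a_0 c_1 c_3 a_3 b_3 c_4 a_4 b_4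
  by (simp add: numeral_eq_Suc)

lemma b_2_real: "real (b 2) = (real r - 1) * real (c 2)"
  using b_2 r_ge_2 by simp

text \<open>
  An eigenfunction that sums to zero over every antipodal class takes, \<open>i\<close> steps from the far end,
  \<open>-1/(r-1)\<close> times its value \<open>i\<close> steps from the centre, if it depends on the distance only.
\<close>

lemma cosines_skew:
  assumes "skew_poly \<theta> = 0"
  shows "\<exists>\<sigma>. cosines \<theta> \<sigma> \<and> \<sigma> 1 = \<theta> / real k \<and> \<sigma> 2 = 0"
proof -
  define \<sigma> :: "nat \<Rightarrow> real" where "\<sigma> i = (if i = 0 then 1 else if i = 1 then \<theta> / real k
    else if i = 2 then 0 else if i = 3 then - \<theta> / ((real r - 1) * real k) else - 1 / (real r - 1))" for i
  have s: "\<sigma> 0 = 1" "\<sigma> 1 = \<theta> / real k" "\<sigma> 2 = 0" "\<sigma> 3 = - \<theta> / ((real r - 1) * real k)" "\<sigma> 4 = - 1 / (real r - 1)"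
    by (simp_all add: \<sigma>_def)
  have r: "real r - 1 \<noteq> 0" "real k \<noteq> 0" using r_ge_2 k_pos by auto
  have e: "\<theta> * \<theta> = real (a 1) * \<theta> + real k" using assms by (simp add: power2_eq_square algebra_simps)
  have "cosines \<theta> \<sigma>"
  proof (rule cosinesI; unfold s b_2_real)
    have "\<theta> * (\<theta> / real k) = (\<theta> * \<theta>) / real k" by simp
    then show "1 + real (a 1) * (\<theta> / real k) + real (b 1) * 0 = \<theta> * (\<theta> / real k)"
      unfolding e using r by (simp add: add_divide_distrib)
    have "\<theta> * (- \<theta> / ((real r - 1) * real k)) = - ((\<theta> * \<theta>) / ((real r - 1) * real k))" by simp
    then show "real (b 1) * 0 + real (a 1) * (- \<theta> / ((real r - 1) * real k)) + - 1 / (real r - 1) =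
        \<theta> * (- \<theta> / ((real r - 1) * real k))"
      unfolding e using r by (simp add: add_divide_distrib)
  qed (use r in simp_all)
  with s show ?thesis by blast
qed

text \<open>
  An eigenfunction coming from the antipodal quotient takes the same value at distances \<open>i\<close> and
  \<open>4 - i\<close>.
\<close>

lemma cosines_folded:
  assumes "folded_poly \<theta> = 0"
  shows "\<exists>\<sigma>. cosines \<theta> \<sigma> \<and> \<sigma> 1 = \<theta> / real k \<and> \<sigma> 2 = skew_poly \<theta> / (real k * real (b 1))"
proof -
  define t where "t = skew_poly \<theta> / (real k * real (b 1))"
  define \<sigma> :: "nat \<Rightarrow> real" where
    "\<sigma> i = (if i = 0 \<or> i = 4 then 1 else if i = 2 then t else \<theta> / real k)" for i
  have s: "\<sigma> 0 = 1" "\<sigma> 1 = \<theta> / real k" "\<sigma> 2 = t" "\<sigma> 3 = \<theta> / real k" "\<sigma> 4 = 1"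
    by (simp_all add: \<sigma>_def)
  have p: "real k \<noteq> 0" "real (b 1) \<noteq> 0" using k_pos b1_pos by auto
  define u where "u = \<theta> / real k"
  have u: "real k * u = \<theta>" using p by (simp add: u_def)
  have t: "real (b 1) * t = \<theta> * u - real (a 1) * u - 1"
    using p by (simp add: t_def u_def field_simps power2_eq_square)
  have "real k * real (b 1) * (real r * real (c 2) * u + (real k - real r * real (c 2) - \<theta>) * t) = 0"
    using assms a_1 t u by algebra
  then have e2: "real r * real (c 2) * u + (real k - real r * real (c 2) - \<theta>) * t = 0" using p by simp
  have "cosines \<theta> \<sigma>"
    by (rule cosinesI; unfold s b_2_real a_2 u_def[symmetric]) (use t u e2 in \<open>simp_all add: algebra_simps\<close>)
  with s show ?thesis unfolding t_def by blast
qed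

lemma cosine_column:
  assumes c: "cosines \<theta> \<sigma>" and z: "z \<in> V"
  shows "eigfun \<theta> (\<lambda>y. \<sigma> (d z y))"
  unfolding eigfun_def
proof
  fix x assume x: "x \<in> V"
  define i where "i = d z x"
  have i: "i \<le> 4" using d_le x z by (simp add: i_def)
  have cnt: "(\<Sum>y\<in>V. if P y then t else 0) = t * real (card {y \<in> V. P y})" for P and t :: real
    using finite_V by (simp add: sum.If_cases Int_def)
  have "(\<Sum>y\<in>nbrs x. \<sigma> (d z y)) = (\<Sum>y\<in>V. if d x y = 1 then \<sigma> (d z y) else 0)"
    by (simp only: nbrs_def sum.inter_filter[OF finite_V])
  also have "\<dots> = (\<Sum>y\<in>V. (if i \<noteq> 0 \<and> d z y = i - 1 \<and> d x y = 1 then \<sigma> (i - 1) else 0)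
      + (if d z y = i \<and> d x y = 1 then \<sigma> i else 0) + (if d z y = Suc i \<and> d x y = 1 then \<sigma> (Suc i) else 0))"
  proof (rule sum.cong[OF refl])
    fix y assume y: "y \<in> V"
    show "(if d x y = 1 then \<sigma> (d z y) else 0) = (if i \<noteq> 0 \<and> d z y = i - 1 \<and> d x y = 1 then \<sigma> (i - 1) else 0)
      + (if d z y = i \<and> d x y = 1 then \<sigma> i else 0) + (if d z y = Suc i \<and> d x y = 1 then \<sigma> (Suc i) else 0)"
    proof (cases "d x y = 1")
      case True
      then show ?thesis using d_near[OF z x y True] by (fold i_def) (elim disjE; simp; arith)
    qed simp
  qed
  also have "\<dots> = \<sigma> (i - 1) * real (card {y \<in> V. i \<noteq> 0 \<and> d z y = i - 1 \<and> d x y = 1})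
      + \<sigma> i * real (card {y \<in> V. d z y = i \<and> d x y = 1})
      + \<sigma> (Suc i) * real (card {y \<in> V. d z y = Suc i \<and> d x y = 1})"
    unfolding sum.distrib cnt ..
  also have "card {y \<in> V. d z y = i \<and> d x y = 1} = a i" using a_card[OF z x] by (simp add: i_def)
  also have "card {y \<in> V. d z y = Suc i \<and> d x y = 1} = b i" using b_card[OF z x] by (simp add: i_def)
  also have "\<sigma> (i - 1) * real (card {y \<in> V. i \<noteq> 0 \<and> d z y = i - 1 \<and> d x y = 1}) =
      (if i = 0 then 0 else real (c i) * \<sigma> (i - 1))"
  proof (cases i)
    case (Suc j) then show ?thesis using c_card[OF z x, of j] by (simp add: i_def)
  qed simp
  finally show "(\<Sum>y\<in>nbrs x. \<sigma> (d z y)) = \<theta> * \<sigma> (d z x)"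
    using c i unfolding cosines_def i_def[symmetric] by (simp add: mult.commute)
qed

text \<open>
  The matrix with entries \<open>\<sigma> (d x z)\<close> has eigenfunctions as columns, and summing \<open>\<sigma>\<close> against an
  eigenfunction amounts to a weighted sum over spheres, hence multiplies the eigenfunction by a
  constant. So the square of this matrix is a multiple of it, positive because of the diagonal.
\<close>

lemma cosine_gram:
  assumes c: "cosines \<theta> \<sigma>"
  shows "\<exists>C>0. \<forall>x\<in>V. \<forall>z\<in>V. (\<Sum>u\<in>V. \<sigma> (d u x) * \<sigma> (d u z)) = C * \<sigma> (d x z)"
proof -
  have "\<forall>i\<in>{..4}. \<exists>t. \<forall>f x. eigfun \<theta> f \<and> x \<in> V \<longrightarrow> (\<Sum>y\<in>sphere x i. f y) = t * f x"
    using sphere_sum_scalar by auto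
  then obtain t where t: "\<And>i f x. i \<le> 4 \<Longrightarrow> eigfun \<theta> f \<Longrightarrow> x \<in> V \<Longrightarrow> (\<Sum>y\<in>sphere x i. f y) = t i * f x"
    unfolding bchoice_iff by auto
  define C where "C = (\<Sum>i\<le>4. \<sigma> i * t i)"
  have gram: "(\<Sum>u\<in>V. \<sigma> (d u x) * \<sigma> (d u z)) = C * \<sigma> (d x z)" if x: "x \<in> V" and z: "z \<in> V" for x z
  proof -
    have "(\<Sum>u\<in>V. \<sigma> (d u x) * \<sigma> (d u z)) = (\<Sum>u\<in>V. \<sigma> (d x u) * \<sigma> (d z u))"
      using d_sym x z by (intro sum.cong refl) simp
    also have "\<dots> = (\<Sum>i\<le>4. \<Sum>u\<in>{u \<in> V. d x u = i}. \<sigma> (d x u) * \<sigma> (d z u))"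
      by (rule sum.group[symmetric]) (use finite_V d_le x in auto)
    also have "\<dots> = (\<Sum>i\<le>4. \<sigma> i * (\<Sum>u\<in>sphere x i. \<sigma> (d z u)))"
      by (intro sum.cong refl) (simp add: sphere_def sum_distrib_left)
    also have "\<dots> = (\<Sum>i\<le>4. \<sigma> i * (t i * \<sigma> (d z x)))"
      using t[OF _ cosine_column[OF c z] x] by (intro sum.cong refl) simp
    also have "\<dots> = C * \<sigma> (d z x)" by (simp add: C_def sum_distrib_right mult.assoc)
    also have "d z x = d x z" using d_sym x z by simp
    finally show ?thesis .
  qed
  obtain x where x: "x \<in> V" using d_far by blast
  have s0: "\<sigma> (d x x) = 1" using c d_zero[OF x x] by (simp add: cosines_def)
  have "0 < (\<sigma> (d x x))\<^sup>2" using s0 by simp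
  also have "\<dots> \<le> (\<Sum>u\<in>V. (\<sigma> (d u x))\<^sup>2)"
    by (rule member_le_sum) (use x finite_V in auto)
  also have "\<dots> = C" using gram[OF x x] s0 by (simp add: power2_eq_square)
  finally show ?thesis using gram by blast
qed

section \<open>Tightness and the local graphs\<close>

text \<open>
  Cosines between neighbours of \<open>x\<close>, after projecting away from \<open>x\<close> itself. The projection is what
  makes the row sums over the local graph vanish.
\<close>

lemma local_gram:
  assumes c: "cosines \<theta> \<sigma>" and x: "x \<in> V"
  shows "\<exists>f. \<forall>y\<in>nbrs x. \<forall>z\<in>nbrs x. \<sigma> (d y z) - (\<sigma> 1)\<^sup>2 = (\<Sum>u\<in>V. f u y * f u z)"
proof -
  obtain C where C: "0 < C" "\<And>x z. x \<in> V \<Longrightarrow> z \<in> V \<Longrightarrow> (\<Sum>u\<in>V. \<sigma> (d u x) * \<sigma> (d u z)) = C * \<sigma> (d x z)"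
    using cosine_gram[OF c] by blast
  define f where "f u y = (\<sigma> (d u y) - \<sigma> 1 * \<sigma> (d u x)) / sqrt C" for u y
  have "\<sigma> (d y z) - (\<sigma> 1)\<^sup>2 = (\<Sum>u\<in>V. f u y * f u z)" if yz: "y \<in> nbrs x" "z \<in> nbrs x" for y z
  proof -
    have V: "y \<in> V" "z \<in> V" "d y x = 1" "d x y = 1" "d x z = 1" "d x x = 0"
      using yz x d_sym d_zero by (auto simp: nbrs_def)
    have s0: "\<sigma> 0 = 1" using c by (simp add: cosines_def)
    have "(\<Sum>u\<in>V. f u y * f u z) = (\<Sum>u\<in>V. (\<sigma> (d u y) * \<sigma> (d u z) - \<sigma> 1 * (\<sigma> (d u x) * \<sigma> (d u z))
        - \<sigma> 1 * (\<sigma> (d u x) * \<sigma> (d u y)) + (\<sigma> 1)\<^sup>2 * (\<sigma> (d u x) * \<sigma> (d u x))) / C)"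
      using C(1) by (intro sum.cong refl) (simp add: f_def power2_eq_square algebra_simps)
    also have "\<dots> = (C * \<sigma> (d y z) - \<sigma> 1 * (C * \<sigma> (d x z)) - \<sigma> 1 * (C * \<sigma> (d x y)) + (\<sigma> 1)\<^sup>2 * (C * \<sigma> (d x x))) / C"
      by (simp only: sum_divide_distrib[symmetric] sum.distrib sum_subtractf sum_distrib_left[symmetric] C(2) V x)
    also have "\<dots> = \<sigma> (d y z) - (\<sigma> 1)\<^sup>2" unfolding V s0 using C(1) by (simp add: field_simps power2_eq_square)
    finally show ?thesis by simp
  qed
  then show ?thesis by blast
qed

lemma local_valency:
  assumes "x \<in> V" "y \<in> nbrs x" shows "card {z \<in> nbrs x. d y z = 1} = a 1"
proof -
  have "{z \<in> nbrs x. d y z = 1} = {z \<in> V. d x z = d x y \<and> d y z = 1}" using assms by (auto simp: nbrs_def)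
  then show ?thesis using a_card[of x y] assms by (simp add: nbrs_def)
qed

lemma local_distance:
  assumes "x \<in> V" "y \<in> nbrs x" "z \<in> nbrs x" "y \<noteq> z" "d y z \<noteq> 1" shows "d y z = 2"
  using assms d_tri[of y x z] d_sym[of x y] d_zero[of y z] by (auto simp: nbrs_def)

text \<open>
  There are exactly four eigenvalues besides the valency, so they are the roots \<open>w < u < -1 < z < v\<close> of
  the two quadratics, where \<open>u\<close>, \<open>v\<close> are those of \<open>skew_poly\<close>; the order holds because the polynomials
  differ by \<open>r c\<^sub>2 (t + 1)\<close>. With \<open>Q = -u\<close> all of \<open>k\<close>, \<open>a\<^sub>1\<close>, \<open>b\<^sub>1\<close> are expressed by \<open>Q\<close> and \<open>v\<close>, and the
  tightness equation becomes \<open>w = -Q\<^sup>2\<close>; then \<open>folded_poly w = 0\<close> yields \<open>r c\<^sub>2\<close>.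
\<close>

lemma tight_parameters:
  fixes \<theta> :: "nat \<Rightarrow> real"
  assumes spec: "\<theta> ` {0..4} = {t. \<exists>f. (\<exists>x\<in>V. f x \<noteq> 0) \<and> eigfun t f}"
    and th0: "\<theta> 0 = real k" and dec: "\<And>i. i < 4 \<Longrightarrow> \<theta> (Suc i) < \<theta> i"
    and tight: "(\<theta> 1 + real k / (real (a 1) + 1)) * (\<theta> 4 + real k / (real (a 1) + 1)) =
      - (real k * real (a 1) * real (b 1) / (real (a 1) + 1)\<^sup>2)"
  obtains P Q :: real where "0 \<le> P" "1 < Q" "real k = Q * (P * Q + P + Q)" "real (a 1) = P * (Q + 1)"
    "real r * real (c 2) = Q * (P + Q)" "skew_poly (P * Q + P + Q) = 0" "folded_poly (- (Q\<^sup>2)) = 0"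
proof -
  have d: "\<theta> 4 < \<theta> 3" "\<theta> 3 < \<theta> 2" "\<theta> 2 < \<theta> 1" "\<theta> 1 < real k"
    using dec[of 3] dec[of 2] dec[of 1] dec[of 0] th0 by (simp_all add: numeral_eq_Suc)
  have "1 - (- real (a 1)) + (- real k) < 0" using a_1 b1_pos by simp
  then obtain u v where uv: "u < -1" "-1 < v" "u + v = real (a 1)" "u * v = - real k"
    using quadratic_split_at_minus_one[of "- real (a 1)" "- real k"] by auto
  let ?m = "real r * real (c 2) - real (a 1)" and ?n = "real r * real (c 2) - real k"
  have "1 - ?m + ?n < 0" using a_1 b1_pos by simp
  then obtain w z where wz: "w < -1" "-1 < z" "w + z = - ?m" "w * z = ?n"
    using quadratic_split_at_minus_one[of ?m ?n] by auto
  have skew_eq: "skew_poly t = (t - u) * (t - v)" for t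
  proof -
    have "(t - u) * (t - v) = t\<^sup>2 - (u + v) * t + u * v" by (simp add: algebra_simps power2_eq_square)
    then show ?thesis unfolding uv by simp
  qed
  have folded_eq: "folded_poly t = (t - w) * (t - z)" for t
  proof -
    have "folded_poly t = t\<^sup>2 + ?m * t + ?n" by (simp add: algebra_simps)
    also have "?m = - (w + z)" using wz(3) by simp
    finally show ?thesis using wz(4) by (simp add: algebra_simps power2_eq_square)
  qed
  have rc: "0 < real r * real (c 2)" using r_ge_2 c2_pos by simp
  have "folded_poly z = 0" "folded_poly w = 0" by (simp_all only: folded_eq) simp_all
  then have "skew_poly z = - (real r * real (c 2)) * (z + 1)" and w: "skew_poly w = real r * real (c 2) * (- 1 - w)"
    by (simp_all add: algebra_simps)
  then have "skew_poly z < 0" "0 < skew_poly w" using rc wz by (simp_all add: mult_pos_pos mult_neg_pos)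
  then have "(z - u) * (z - v) < 0" "0 < (w - u) * (w - v)" unfolding skew_eq by auto
  then have zv: "z < v" and wu: "w < u" using uv wz by (auto simp: mult_less_0_iff zero_less_mult_iff)
  have mem: "\<theta> i = w \<or> \<theta> i = u \<or> \<theta> i = z \<or> \<theta> i = v" if "1 \<le> i" "i \<le> 4" for i
  proof -
    have "\<theta> i \<in> \<theta> ` {0..4}" using that by auto
    then obtain f x where "x \<in> V" "f x \<noteq> 0" "eigfun (\<theta> i) f" unfolding spec by blast
    then have "\<theta> i = real k \<or> skew_poly (\<theta> i) = 0 \<or> folded_poly (\<theta> i) = 0" using eigenvalue_cases by blast
    moreover have "i = 1 \<or> i = 2 \<or> i = 3 \<or> i = 4" using that by auto
    then have "\<theta> i < real k" using d by auto
    moreover have "\<theta> i = u \<or> \<theta> i = v" if "skew_poly (\<theta> i) = 0" using skew_eq[of "\<theta> i"] that by simp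
    moreover have "\<theta> i = w \<or> \<theta> i = z" if "folded_poly (\<theta> i) = 0" using folded_eq[of "\<theta> i"] that by simp
    ultimately show ?thesis by auto
  qed
  note m = mem[of 1] mem[of 2] mem[of 3] mem[of 4]
  have th4: "\<theta> 4 = w"
  proof -
    have "\<theta> 2 \<noteq> v" using m(1) d zv wu uv wz by auto
    moreover have "\<theta> 3 \<noteq> v" using m(1) d zv wu uv wz by auto
    moreover have "\<theta> 4 \<noteq> v" using m(1) d zv wu uv wz by auto
    ultimately have "\<theta> 3 \<noteq> z" "\<theta> 4 \<noteq> z" using m(2) d zv wu uv wz by auto
    then have "\<theta> 4 \<noteq> u" using m(3) d zv wu uv wz \<open>\<theta> 3 \<noteq> v\<close> by auto
    then show ?thesis using m(4) \<open>\<theta> 4 \<noteq> v\<close> \<open>\<theta> 4 \<noteq> z\<close> by auto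
  qed
  have th1: "\<theta> 1 = v"
  proof -
    have "\<theta> 3 \<noteq> w" "\<theta> 2 \<noteq> w" "\<theta> 1 \<noteq> w" using th4 d by auto
    then have "\<theta> 2 \<noteq> u" "\<theta> 1 \<noteq> u" using m(3) d zv wu uv wz by auto
    then have "\<theta> 1 \<noteq> z" using m(2) d zv wu uv wz \<open>\<theta> 2 \<noteq> w\<close> by auto
    then show ?thesis using m(1) \<open>\<theta> 1 \<noteq> w\<close> \<open>\<theta> 1 \<noteq> u\<close> by auto
  qed
  define Q where "Q = - u"
  define A where "A = real (a 1)"
  have Q: "1 < Q" using uv by (simp add: Q_def)
  have kQ: "real k = Q * v" and A: "A = v - Q" and A0: "0 \<le> A"
    using uv by (simp_all add: Q_def A_def)
  have v: "0 < v" using kQ k_pos Q by (simp add: zero_less_mult_iff)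
  have b1: "real (b 1) = (v + 1) * (Q - 1)" using a_1 kQ A unfolding A_def by (simp add: algebra_simps)
  have wQ: "w = - (Q\<^sup>2)"
  proof -
    have A1: "A + 1 \<noteq> 0" using A0 by simp
    have "(v + real k / (A + 1)) * (w + real k / (A + 1)) * (A + 1)\<^sup>2 = - (real k * A * real (b 1))"
      using tight A1 unfolding th1 th4 A_def[symmetric] by (simp add: field_simps)
    moreover have "(v + real k / (A + 1)) * (A + 1) = v * (A + 1) + real k"
      "(w + real k / (A + 1)) * (A + 1) = w * (A + 1) + real k" using A1 by (simp_all add: field_simps)
    ultimately have "(v * (A + 1) + real k) * (w * (A + 1) + real k) = - (real k * A * real (b 1))"
      by algebra
    then have "v * (v + 1) * ((w + Q\<^sup>2) * (A + 1)) = 0" unfolding kQ b1 A by algebra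
    then show ?thesis using v A1 by auto
  qed
  define P where "P = A / (Q + 1)"
  have P: "A = P * (Q + 1)" using Q by (simp add: P_def)
  have vP: "v = P * Q + P + Q" using P A by algebra
  have "folded_poly (- (Q\<^sup>2)) = 0" using folded_eq[of w] wQ by simp
  moreover have "skew_poly (P * Q + P + Q) = 0" using skew_eq[of v] vP by simp
  moreover have "real r * real (c 2) = Q * (P + Q)"
  proof -
    have "(Q\<^sup>2 - 1) * (real r * real (c 2) - Q * (P + Q)) = 0"
      using \<open>folded_poly (- (Q\<^sup>2)) = 0\<close> unfolding A_def[symmetric] kQ P vP by algebra
    moreover have "Q\<^sup>2 \<noteq> 1" using Q by (simp add: power2_eq_1_iff)
    ultimately show ?thesis by simp
  qed
  moreover have "0 \<le> P" using A0 Q by (simp add: P_def)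
  ultimately show ?thesis using that[of P Q] Q kQ vP P A_def by simp
qed

text \<open>
  Let \<open>\<alpha> = PQ + P + Q\<close> be the second largest eigenvalue. Up to positive factors, the projected cosine
  matrices of \<open>-Q\<^sup>2\<close> and \<open>\<alpha>\<close> on the local graph are \<open>X = P - A + (P/\<alpha>)J\<close> and \<open>Y = A + Q - J/Q\<close>. The diagonal
  of \<open>XY\<close> vanishes, so the trace does and therefore the whole product, and the other entries of
  \<open>XY = 0\<close> are the asserted codegrees.
\<close>

lemma local_codegree:
  fixes P Q :: real
  assumes PQ: "0 \<le> P" "1 < Q" and kPQ: "real k = Q * (P * Q + P + Q)" and aPQ: "real (a 1) = P * (Q + 1)"
    and skew0: "skew_poly (P * Q + P + Q) = 0" and folded0: "folded_poly (- (Q\<^sup>2)) = 0"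
    and x: "x \<in> V" and y: "y \<in> nbrs x" and w: "w \<in> nbrs x" and yw: "y \<noteq> w"
  shows "real (card ({z \<in> nbrs x. d y z = 1} \<inter> {z \<in> nbrs x. d w z = 1})) =
    (if d y w = 1 then 2 * P - Q else P)"
proof -
  define \<alpha> where "\<alpha> = P * Q + P + Q"
  have \<alpha>: "0 < \<alpha>" using PQ by (simp add: \<alpha>_def add_nonneg_pos)
  have kQ: "real k = Q * \<alpha>" using kPQ by (simp add: \<alpha>_def)
  have b1: "real (b 1) = (Q\<^sup>2 - 1) * (P + 1)" using a_1 kPQ aPQ by algebra
  obtain \<tau> where \<tau>: "cosines \<alpha> \<tau>" "\<tau> 1 = \<alpha> / real k" "\<tau> 2 = 0"
    using cosines_skew[OF skew0] unfolding \<alpha>_def by blast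
  obtain \<sigma> where \<sigma>: "cosines (- (Q\<^sup>2)) \<sigma>" "\<sigma> 1 = - (Q\<^sup>2) / real k"
      "\<sigma> 2 = skew_poly (- (Q\<^sup>2)) / (real k * real (b 1))"
    using cosines_folded[OF folded0] by blast
  define p q where "p = P + 1" and "q = Q\<^sup>2 - 1"
  have Q0: "Q \<noteq> 0" "\<alpha> \<noteq> 0" "p \<noteq> 0" "q \<noteq> 0" using PQ \<alpha> by (auto simp: p_def q_def power2_eq_1_iff)
  have t1: "\<tau> 1 = 1 / Q" using \<tau>(2) Q0 by (simp add: kQ)
  have s1: "\<sigma> 1 = - Q / \<alpha>" using \<sigma>(2) Q0 by (simp add: kQ power2_eq_square)
  have s2: "\<sigma> 2 = (P + Q) / (\<alpha> * p)"
  proof -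
    have "skew_poly (- (Q\<^sup>2)) = q * (Q * (P + Q))" unfolding aPQ kPQ q_def by algebra
    moreover have "real k * real (b 1) = q * (Q * (\<alpha> * p))" unfolding b1 kQ p_def q_def by simp
    ultimately show ?thesis using \<sigma>(3) Q0 by simp
  qed
  define e where "e = (Q * p + P + Q) / (\<alpha> * p)"
  have e0: "e \<noteq> 0" using PQ Q0 by (auto simp: e_def p_def add_nonneg_eq_0_iff)
  let ?adj = "\<lambda>y z. d y z = 1"
  define X where "X y z = P / \<alpha> + (- 1) * of_bool (?adj y z) + P * of_bool (y = z)" for y z
  define Y where "Y y z = - (1 / Q) + 1 * of_bool (?adj y z) + Q * of_bool (y = z)" for y z
  have V: "y \<in> V" if "y \<in> nbrs x" for y using that by (simp add: nbrs_def)
  have sym: "?adj u v = ?adj v u" if "u \<in> nbrs x" "v \<in> nbrs x" for u v using d_sym V that by simp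
  have dist: "y = z \<and> d y z = 0 \<or> y \<noteq> z \<and> d y z = 1 \<or> y \<noteq> z \<and> d y z = 2"
    if "y \<in> nbrs x" "z \<in> nbrs x" for y z
    using local_distance[OF x that] d_zero[OF V V, OF that] by auto
  have Xs: "\<sigma> (d y z) - (\<sigma> 1)\<^sup>2 = e * X y z" if yz: "y \<in> nbrs x" "z \<in> nbrs x" for y z
  proof -
    have m: "\<alpha> * p - (P + Q) = P * (Q * p + P + Q)" unfolding \<alpha>_def p_def by algebra
    have "(P + Q) * \<alpha> - Q\<^sup>2 * p = P * (Q * p + P + Q)" unfolding \<alpha>_def p_def by algebra
    then have x0: "(P + Q) / (\<alpha> * p) - (Q / \<alpha>)\<^sup>2 = e * (P / \<alpha>)"
      unfolding e_def using Q0 by (simp add: field_simps power2_eq_square)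
    have x1: "- Q / \<alpha> - (P + Q) / (\<alpha> * p) = - e" unfolding e_def using Q0 by (simp add: field_simps)
    have "1 - (P + Q) / (\<alpha> * p) = (\<alpha> * p - (P + Q)) / (\<alpha> * p)" using Q0 by (simp add: field_simps)
    then have x2: "1 - (P + Q) / (\<alpha> * p) = e * P" unfolding m e_def by simp
    have "\<sigma> 0 = 1" using \<sigma>(1) by (simp add: cosines_def)
    then show ?thesis
      using x0 x1 x2 dist[OF yz] unfolding X_def
      by (elim disjE conjE; simp add: s1[unfolded One_nat_def] s2 algebra_simps power2_eq_square)
  qed
  have Ys: "\<tau> (d y z) - (\<tau> 1)\<^sup>2 = (1 / Q) * Y y z" if yz: "y \<in> nbrs x" "z \<in> nbrs x" for y z
  proof -
    have "\<tau> 0 = 1" using \<tau>(1) by (simp add: cosines_def)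
    then show ?thesis
      using dist[OF yz] Q0 unfolding Y_def
      by (elim disjE conjE; simp add: t1[unfolded One_nat_def] \<tau>(3) algebra_simps power2_eq_square)
  qed
  let ?L = "\<lambda>y w. real (card ({z \<in> nbrs x. d y z = 1} \<inter> {z \<in> nbrs x. d w z = 1}))"
  have prod: "(\<Sum>z\<in>nbrs x. X y z * Y z w) =
      P + (P - Q) * of_bool (?adj y w) + P * Q * of_bool (y = w) - ?L y w"
    if y: "y \<in> nbrs x" and w: "w \<in> nbrs x" for y w
  proof -
    have "(\<Sum>z\<in>nbrs x. X y z * Y z w) =
        P / \<alpha> * - (1 / Q) * real k + P / \<alpha> * 1 * real (a 1) + P / \<alpha> * Q
        + (- 1) * - (1 / Q) * real (a 1) + (- 1) * 1 * ?L y w + (- 1) * Q * of_bool (?adj y w)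
        + P * - (1 / Q) + P * 1 * of_bool (?adj y w) + P * Q * of_bool (y = w)"
      unfolding X_def Y_def
      using kernel_product[where adj = ?adj and a = "P / \<alpha>" and b = "- 1" and c = P
          and a' = "- (1 / Q)" and b' = 1 and c' = Q, OF finite_nbrs y w sym]
      by (simp only: local_valency[OF x y] local_valency[OF x w] valency[OF x])
    also have "\<dots> = P / \<alpha> * (real (a 1) + Q - real k / Q) + (real (a 1) - P) / Q - ?L y w
        + (P - Q) * of_bool (?adj y w) + P * Q * of_bool (y = w)"
      using Q0 by (simp add: field_simps)
    also have "real (a 1) + Q = \<alpha>" unfolding aPQ \<alpha>_def by algebra
    also have "real k / Q = \<alpha>" using Q0 by (simp add: kQ)
    also have "(real (a 1) - P) / Q = P" unfolding aPQ using Q0 by (simp add: field_simps)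
    finally show ?thesis by simp
  qed
  obtain f where f: "\<And>y z. y \<in> nbrs x \<Longrightarrow> z \<in> nbrs x \<Longrightarrow> e * X y z = (\<Sum>u\<in>V. f u y * f u z)"
    using local_gram[OF \<sigma>(1) x] Xs by metis
  obtain g where g: "\<And>y z. y \<in> nbrs x \<Longrightarrow> z \<in> nbrs x \<Longrightarrow> 1 / Q * Y y z = (\<Sum>u\<in>V. g u y * g u z)"
    using local_gram[OF \<tau>(1) x] Ys by metis
  have "(\<Sum>z\<in>nbrs x. e * X y z * (1 / Q * Y z w)) = 0"
  proof (rule gram_trace_zero[OF finite_V finite_V f g _ y w])
    have "(\<Sum>z\<in>nbrs x. e * X y z * (1 / Q * Y y z)) = 0" if y: "y \<in> nbrs x" for y
    proof -
      have "(\<Sum>z\<in>nbrs x. e * X y z * (1 / Q * Y y z)) = e * (1 / Q) * (\<Sum>z\<in>nbrs x. X y z * Y z y)"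
        using sym y by (simp add: Y_def sum_distrib_left mult_ac eq_commute)
      also have "(\<Sum>z\<in>nbrs x. X y z * Y z y) = 0"
        using prod[OF y y] d_zero[OF V V, OF y y] local_valency[OF x y] aPQ by (simp add: algebra_simps)
      finally show ?thesis by simp
    qed
    then show "(\<Sum>y\<in>nbrs x. \<Sum>z\<in>nbrs x. e * X y z * (1 / Q * Y y z)) = 0" by simp
  qed
  then have "e * (1 / Q) * (\<Sum>z\<in>nbrs x. X y z * Y z w) = 0"
    by (simp add: sum_distrib_left mult_ac)
  then have "(\<Sum>z\<in>nbrs x. X y z * Y z w) = 0" using e0 Q0 by simp
  then show ?thesis using prod[OF y w] yw by (cases "d y w = 1") simp_all
qed

text \<open>
  An eigenfunction for an eigenvalue other than the valency sums to zero, so on it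
  \<open>A\<^sup>2 = (P - Q)A + PQ + PJ\<close> becomes a quadratic equation for the eigenvalue.
\<close>

lemma local_eigenvalue:
  fixes P Q :: real
  assumes aPQ: "real (a 1) = P * (Q + 1)" and x: "x \<in> V"
    and codeg: "\<And>y w. y \<in> nbrs x \<Longrightarrow> w \<in> nbrs x \<Longrightarrow> y \<noteq> w \<Longrightarrow>
      real (card ({z \<in> nbrs x. d y z = 1} \<inter> {z \<in> nbrs x. d w z = 1})) = (if d y w = 1 then 2 * P - Q else P)"
    and f: "\<And>y. y \<in> nbrs x \<Longrightarrow> (\<Sum>z\<in>{z \<in> nbrs x. d y z = 1}. f z) = \<theta> * f y"
    and y: "y \<in> nbrs x" "f y \<noteq> 0" and nontriv: "\<theta> \<noteq> real (a 1)"
  shows "\<theta> = P \<or> \<theta> = - Q"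
proof -
  let ?A = "\<lambda>y. {z \<in> nbrs x. d y z = 1}"
  have V: "z \<in> V" if "z \<in> nbrs x" for z using that by (simp add: nbrs_def)
  have S: "(\<Sum>z\<in>?A y. h z) = (\<Sum>z\<in>nbrs x. of_bool (d y z = 1) * h z)" for y and h :: "'v \<Rightarrow> real"
    by (simp only: sum.inter_filter[OF finite_nbrs]) (intro sum.cong refl, simp)
  have "\<theta> * (\<Sum>y\<in>nbrs x. f y) = (\<Sum>y\<in>nbrs x. \<Sum>z\<in>?A y. f z)" unfolding sum_distrib_left by (intro sum.cong refl) (simp only: f)
  also have "\<dots> = (\<Sum>z\<in>nbrs x. \<Sum>y\<in>nbrs x. of_bool (d y z = 1) * f z)" unfolding S by (rule sum.swap)
  also have "\<dots> = (\<Sum>z\<in>nbrs x. real (a 1) * f z)"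
  proof (rule sum.cong[OF refl])
    fix z assume z: "z \<in> nbrs x"
    have "(\<Sum>y\<in>nbrs x. of_bool (d y z = 1) * f z) = (\<Sum>y\<in>nbrs x. of_bool (d z y = 1)) * f z"
      using d_sym V z by (simp add: sum_distrib_right cong: sum.cong)
    then show "(\<Sum>y\<in>nbrs x. of_bool (d y z = 1) * f z) = real (a 1) * f z"
      by (simp only: sum_of_bool_card[OF finite_nbrs] local_valency[OF x z])
  qed
  finally have "(\<theta> - real (a 1)) * (\<Sum>y\<in>nbrs x. f y) = 0"
    unfolding sum_distrib_left[symmetric] by (simp add: left_diff_distrib)
  then have sum0: "(\<Sum>y\<in>nbrs x. f y) = 0" using nontriv by simp
  have "\<theta> * (\<theta> * f y) = (\<Sum>z\<in>?A y. \<theta> * f z)" using f[OF y(1)] by (simp add: sum_distrib_left[symmetric])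
  also have "\<dots> = (\<Sum>z\<in>nbrs x. of_bool (d y z = 1) * (\<Sum>w\<in>?A z. f w))" unfolding S[of "\<lambda>z. \<theta> * f z"]
    by (intro sum.cong refl) (simp only: f)
  also have "\<dots> = (\<Sum>z\<in>nbrs x. \<Sum>w\<in>nbrs x. of_bool (d y z = 1 \<and> d w z = 1) * f w)"
    unfolding S sum_distrib_left using d_sym V by (intro sum.cong refl) (simp add: of_bool_conj)
  also have "\<dots> = (\<Sum>w\<in>nbrs x. \<Sum>z\<in>nbrs x. of_bool (d y z = 1 \<and> d w z = 1) * f w)" by (rule sum.swap)
  also have "\<dots> = (\<Sum>w\<in>nbrs x. (P - Q) * (of_bool (d y w = 1) * f w) + P * f w
      + (if w = y then P * Q * f y else 0))"
  proof (rule sum.cong[OF refl])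
    fix w assume w: "w \<in> nbrs x"
    have both: "{z \<in> nbrs x. d y z = 1 \<and> d w z = 1} = ?A y \<inter> ?A w" by auto
    have "(\<Sum>z\<in>nbrs x. of_bool (d y z = 1 \<and> d w z = 1) * f w) = real (card (?A y \<inter> ?A w)) * f w"
      by (simp only: sum_distrib_right[symmetric] sum_of_bool_card[OF finite_nbrs] both)
    also have "\<dots> = (P - Q) * (of_bool (d y w = 1) * f w) + P * f w + (if w = y then P * Q * f y else 0)"
    proof (cases "w = y")
      case True
      then show ?thesis using local_valency[OF x y(1)] aPQ d_zero[OF V V, OF y(1) y(1)]
        by (simp add: algebra_simps)
    next
      case False
      then show ?thesis using codeg[OF y(1) w] by (simp add: algebra_simps)
    qed
    finally show "(\<Sum>z\<in>nbrs x. of_bool (d y z = 1 \<and> d w z = 1) * f w) =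
      (P - Q) * (of_bool (d y w = 1) * f w) + P * f w + (if w = y then P * Q * f y else 0)" .
  qed
  also have "\<dots> = (P - Q) * (\<theta> * f y) + P * 0 + P * Q * f y"
    using y(1) f[OF y(1)]
    by (simp only: sum.distrib sum_distrib_left[symmetric] sum0 S sum.delta finite_nbrs) simp
  finally have "(\<theta> - P) * (\<theta> + Q) * f y = 0" by algebra
  then show ?thesis using y(2) by (auto simp: eq_neg_iff_add_eq_0)
qed

section \<open>Common neighbours at distance two\<close>

lemma common_nbrs_card:
  assumes "u \<in> V" "w \<in> V" "d u w = 2" shows "card (nbrs u \<inter> nbrs w) = c 2"
proof -
  have "nbrs u \<inter> nbrs w = {z \<in> V. d u z = 1 \<and> d w z = 1}" by (auto simp: nbrs_def)
  then show ?thesis using c_card[of u w 1] assms by (simp add: numeral_eq_Suc)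
qed

text \<open>
  Inside the local graph at \<open>y\<close> the vertices \<open>u\<close> and \<open>w\<close> are non-adjacent, so \<open>y\<close> is adjacent to \<open>qs\<close> of
  the \<open>q(s + 1)\<close> common neighbours of \<open>u\<close> and \<open>w\<close>.
\<close>

lemma mu_graph_nonneighbours:
  fixes q s :: nat
  assumes c2: "c 2 = q * (s + 1)" and q: "1 \<le> q"
    and codeg: "\<And>x y w. x \<in> V \<Longrightarrow> y \<in> nbrs x \<Longrightarrow> w \<in> nbrs x \<Longrightarrow> y \<noteq> w \<Longrightarrow> d y w \<noteq> 1 \<Longrightarrow>
      card ({z \<in> nbrs x. d y z = 1} \<inter> {z \<in> nbrs x. d w z = 1}) = q * s"
    and u: "u \<in> V" "w \<in> V" "d u w = 2" and y: "y \<in> nbrs u \<inter> nbrs w"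
  shows "card {z \<in> nbrs u \<inter> nbrs w. z \<noteq> y \<and> d y z \<noteq> 1} = q - 1"
proof -
  let ?M = "nbrs u \<inter> nbrs w"
  let ?A = "{z \<in> ?M. d y z = 1}" and ?B = "{z \<in> ?M. z \<noteq> y \<and> d y z \<noteq> 1}"
  have yV: "y \<in> V" and uw: "u \<in> nbrs y" "w \<in> nbrs y" "u \<noteq> w" "d u w \<noteq> 1"
    using y u d_sym d_zero[of u w] by (auto simp: nbrs_def)
  have "?A = {z \<in> nbrs y. d u z = 1} \<inter> {z \<in> nbrs y. d w z = 1}" by (auto simp: nbrs_def)
  then have A: "card ?A = q * s" using codeg[OF yV uw] by simp
  have "card (insert y (?A \<union> ?B)) = Suc (card (?A \<union> ?B))"
    using d_zero[OF yV yV] by (intro card_insert_disjoint) auto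
  also have "card (?A \<union> ?B) = card ?A + card ?B" by (rule card_Un_disjoint) auto
  also have "insert y (?A \<union> ?B) = ?M" using y by auto
  finally show ?thesis using A c2 common_nbrs_card[OF u] by (simp add: algebra_simps)
qed

text \<open>
  The local graph at any vertex \<open>x\<close> meets the requirements of both bounds on \<open>s\<close>. For \<open>q = 2\<close> this
  needs that the unique non-neighbour \<open>t\<close> of \<open>y\<close> among the common neighbours of \<open>u\<close> and \<open>w\<close> lies
  in the local graph; otherwise \<open>t\<close> would have both \<open>x\<close> and \<open>y\<close> as non-neighbours there.
\<close>

lemma at4_bound:
  fixes q s :: nat
  assumes q: "2 \<le> q" and s: "1 \<le> s"
    and kq: "k = q\<^sup>2 * (q * s + s + 1)" and aq: "a 1 = q * s * (q + 1)" and c2: "c 2 = q * (s + 1)"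
    and codeg_adj: "\<And>x y w. x \<in> V \<Longrightarrow> y \<in> nbrs x \<Longrightarrow> w \<in> nbrs x \<Longrightarrow> y \<noteq> w \<Longrightarrow> d y w = 1 \<Longrightarrow>
      card ({z \<in> nbrs x. d y z = 1} \<inter> {z \<in> nbrs x. d w z = 1}) + q = 2 * q * s"
    and codeg: "\<And>x y w. x \<in> V \<Longrightarrow> y \<in> nbrs x \<Longrightarrow> w \<in> nbrs x \<Longrightarrow> y \<noteq> w \<Longrightarrow> d y w \<noteq> 1 \<Longrightarrow>
      card ({z \<in> nbrs x. d y z = 1} \<inter> {z \<in> nbrs x. d w z = 1}) = q * s"
  shows "s \<le> q"
proof -
  obtain x where x: "x \<in> V" using d_far by blast
  have V: "y \<in> V" "d x y = 1" if "y \<in> nbrs x" for y using that by (auto simp: nbrs_def)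
  have V': "x \<in> nbrs y" if "y \<in> nbrs x" for y using that x d_sym by (auto simp: nbrs_def)
  have q1: "1 \<le> q" using q by simp
  have mu: "card {z \<in> nbrs u \<inter> nbrs w. z \<noteq> y \<and> d y z \<noteq> 1} = q - 1"
    if uw: "u \<in> V" "w \<in> V" "d u w = 2" "y \<in> nbrs u \<inter> nbrs w" for u w y
    using codeg by (intro mu_graph_nonneighbours[OF c2 q1 _ uw])
  interpret L: local_srg "nbrs x" "\<lambda>y z. d y z = 1" q s
  proof
    fix u w y
    assume h: "u \<in> nbrs x" "w \<in> nbrs x" "u \<noteq> w" "d u w \<noteq> 1" "y \<in> nbrs x" "d u y = 1" "d w y = 1"
    have "d u w = 2" using local_distance[OF x] h by blast
    then have "card {z \<in> nbrs u \<inter> nbrs w. z \<noteq> y \<and> d y z \<noteq> 1} = q - 1"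
      using mu[of u w y] V(1)[OF h(1)] V(1)[OF h(2)] V(1)[OF h(5)] h(6,7) by (simp add: nbrs_def)
    moreover have "card {z \<in> nbrs x. d u z = 1 \<and> d w z = 1 \<and> z \<noteq> y \<and> d y z \<noteq> 1}
        \<le> card {z \<in> nbrs u \<inter> nbrs w. z \<noteq> y \<and> d y z \<noteq> 1}"
      by (rule card_mono) (auto simp: nbrs_def)
    ultimately show "card {z \<in> nbrs x. d u z = 1 \<and> d w z = 1 \<and> z \<noteq> y \<and> d y z \<noteq> 1} < q" using q by simp
  next
    fix y z assume "y \<in> nbrs x" "z \<in> nbrs x" "d y z = 1"
    then show "card ({za \<in> nbrs x. d y za = 1} \<inter> {za \<in> nbrs x. d z za = 1}) + q = 2 * q * s"
      using codeg_adj[OF x, of y z] d_zero[OF V(1) V(1), of z z] by fastforce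
  next
    fix y z assume "y \<in> nbrs x" "z \<in> nbrs x" 
    then show "(d y z = 1) = (d z y = 1)" using d_sym[OF V(1) V(1)] by simp
  next
    fix y assume "y \<in> nbrs x" 
    then show "d y y \<noteq> 1" using d_zero[OF V(1) V(1), of y y] by simp
  next
    fix y z assume "y \<in> nbrs x" "z \<in> nbrs x" "y \<noteq> z" "d y z \<noteq> 1"
    then show "card ({za \<in> nbrs x. d y za = 1} \<inter> {za \<in> nbrs x. d z za = 1}) = q * s"
      by (rule codeg[OF x])
  next
    fix y assume "y \<in> nbrs x"
    then show "card {z \<in> nbrs x. d y z = 1} = q * s * (q + 1)" using local_valency[OF x] aq by simp
  next
    show "card (nbrs x) = q\<^sup>2 * (q * s + s + 1)" using valency[OF x] kq by simp
  qed (use q s in auto)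
  have main: "(real q - 2) * real s \<le> real q" by (rule L.q_minus_two_bound)
  show "s \<le> q"
  proof (cases "q = 2")
    case True
    have "s \<le> 2"
    proof (rule L.q_two_bound[OF True])
      fix u w y
      assume h: "u \<in> nbrs x" "w \<in> nbrs x" "u \<noteq> w" "d u w \<noteq> 1" "y \<in> L.nb u \<inter> L.nb w"
      let ?M = "nbrs u \<inter> nbrs w"
      have uw: "u \<in> V" "w \<in> V" "d u w = 2" using local_distance[OF x h(1-4)] V(1)[OF h(1)] V(1)[OF h(2)] by auto
      have yx: "y \<in> nbrs x" "d u y = 1" "d w y = 1" using h(5) unfolding L.nb_def by auto
      have y: "y \<in> ?M" "y \<in> V" "d x y = 1" and xM: "x \<in> ?M"
        using yx V[OF yx(1)] uw V'[OF h(1)] V'[OF h(2)] by (auto simp: nbrs_def)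
      have M1: "card {z \<in> ?M. z \<noteq> v \<and> d v z \<noteq> 1} = 1" if "v \<in> ?M" for v
        using mu[OF uw that] True by simp
      have "{z \<in> L.nb u \<inter> L.nb w. z \<noteq> y \<and> d y z \<noteq> 1} = {z \<in> ?M. z \<noteq> y \<and> d y z \<noteq> 1}"
      proof (intro equalityI subsetI)
        fix t assume t: "t \<in> {z \<in> ?M. z \<noteq> y \<and> d y z \<noteq> 1}"
        then have tV: "t \<in> V" by (auto simp: nbrs_def)
        have "d x t = 1"
        proof (rule ccontr)
          assume "d x t \<noteq> 1"
          moreover have "t \<noteq> x" using t y d_sym[of x y] x by auto
          ultimately have "{x, y} \<subseteq> {z \<in> ?M. z \<noteq> t \<and> d t z \<noteq> 1}"
            using t xM y x tV d_sym[of x t] d_sym[of y t] by auto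
          then have "card {x, y} \<le> card {z \<in> ?M. z \<noteq> t \<and> d t z \<noteq> 1}" by (intro card_mono) auto
          moreover have "x \<noteq> y" using y(3) d_zero[OF x x] by auto
          then have "card {x, y} = 2" by simp
          ultimately show False using M1[of t] t by simp
        qed
        then have "t \<in> nbrs x" using tV by (simp add: nbrs_def)
        moreover have "d u t = 1" "d w t = 1" using t by (auto simp: nbrs_def)
        ultimately show "t \<in> {z \<in> L.nb u \<inter> L.nb w. z \<noteq> y \<and> d y z \<noteq> 1}"
          using t unfolding L.nb_def by simp
      next
        fix t assume t: "t \<in> {z \<in> L.nb u \<inter> L.nb w. z \<noteq> y \<and> d y z \<noteq> 1}"
        then have "t \<in> V" "d u t = 1" "d w t = 1" using V(1)[of t] unfolding L.nb_def by auto
        then show "t \<in> {z \<in> ?M. z \<noteq> y \<and> d y z \<noteq> 1}" using t by (simp add: nbrs_def)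
      qed
      then show "card {z \<in> L.nb u \<inter> L.nb w. z \<noteq> y \<and> d y z \<noteq> 1} = 1" using M1[OF y(1)] by simp
    qed
    with True show ?thesis by simp
  next
    case False
    then have q3: "3 \<le> real q" using q by simp
    show ?thesis
    proof (rule ccontr)
      assume "\<not> s \<le> q"
      then have "real q + 1 \<le> real s" by simp
      then have "(real q - 2) * (real q + 1) \<le> (real q - 2) * real s" using q3 by (intro mult_left_mono) auto
      moreover have "3 * real q \<le> real q * real q" using q3 by (intro mult_right_mono) auto
      moreover have "(real q - 2) * (real q + 1) = real q * real q - real q - 2" by (simp add: algebra_simps)
      ultimately show False using main q3 by linarith
    qed
  qed
qed

end

section \<open>The path metric of a connected graph\<close>

context graph begin

lemma gdist_le: "awalk x p y \<Longrightarrow> gdist G x y \<le> length p"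
  unfolding gdist_def by (rule Least_le) blast

lemma awalk_reverse: "awalk x p y \<Longrightarrow> \<exists>p'. awalk y p' x \<and> length p' = length p"
proof (induction p arbitrary: x)
  case Nil then show ?case by (intro exI[of _ "[]"]) (auto simp: awalk_Nil_iff)
next
  case (Cons e p)
  then have e: "e \<in> arcs G" "x = tail G e" "awalk (head G e) p y" by (auto simp: awalk_Cons_iff)
  obtain p' where p': "awalk y p' (head G e)" "length p' = length p" using Cons.IH[OF e(3)] by blast
  obtain e' where e': "e' \<in> arcs G" "tail G e' = head G e" "head G e' = tail G e"
    using sym_arcs e(1) unfolding symmetric_conv by metis
  then have "awalk (head G e) [e'] x" using arc_implies_awalk[OF e'(1)] e(2) by simp
  then have "awalk y (p' @ [e']) x" using p'(1) by (rule awalk_appendI[rotated])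
  then show ?case using p'(2) by (intro exI[of _ "p' @ [e']"]) simp
qed

lemma dominates_awalk: "x \<rightarrow>\<^bsub>G\<^esub> y \<Longrightarrow> \<exists>e. awalk x [e] y"
  using arc_implies_awalk unfolding arcs_ends_conv by blast

context
  assumes conn: "Digraph_Component.connected G"
begin

lemma gdist_awalk:
  assumes "x \<in> verts G" "y \<in> verts G"
  shows "\<exists>p. awalk x p y \<and> length p = gdist G x y"
proof -
  have "x \<rightarrow>\<^sup>*\<^bsub>mk_symmetric G\<^esub> y"
    using conn assms unfolding connected_def strongly_connected_def by simp
  then have "x \<rightarrow>\<^sup>*\<^bsub>G\<^esub> y" using reachable_mk_symmetric_eq[OF sym_arcs] by simp
  then obtain p where "awalk x p y" unfolding reachable_awalk by blast
  then have "\<exists>n p. awalk x p y \<and> length p = n" by blast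
  then show ?thesis unfolding gdist_def by (rule LeastI_ex)
qed

lemma gdist_triangle:
  assumes "x \<in> verts G" "y \<in> verts G" "z \<in> verts G"
  shows "gdist G x z \<le> gdist G x y + gdist G y z"
proof -
  obtain p where p: "awalk x p y" "length p = gdist G x y" using gdist_awalk assms by blast
  obtain p' where p': "awalk y p' z" "length p' = gdist G y z" using gdist_awalk assms by blast
  show ?thesis using gdist_le[OF awalk_appendI[OF p(1) p'(1)]] p p' by simp
qed

lemma gdist_sym:
  assumes "x \<in> verts G" "y \<in> verts G" shows "gdist G x y = gdist G y x"
proof -
  have "gdist G v u \<le> gdist G u v" if "u \<in> verts G" "v \<in> verts G" for u v
    using gdist_awalk[OF that] awalk_reverse gdist_le by metis
  then show ?thesis using assms by (simp add: antisym)
qed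

lemma gdist_0_iff:
  assumes "x \<in> verts G" "y \<in> verts G" shows "gdist G x y = 0 \<longleftrightarrow> x = y"
proof
  assume "gdist G x y = 0"
  then show "x = y" using gdist_awalk[OF assms] by (auto simp: awalk_Nil_iff)
next
  assume "x = y"
  then have e: "awalk x [] y" using assms by (simp add: awalk_Nil_iff)
  show "gdist G x y = 0" using gdist_le[OF e] by simp
qed

lemma gdist_1_iff:
  assumes "x \<in> verts G" "y \<in> verts G" shows "gdist G x y = 1 \<longleftrightarrow> x \<rightarrow>\<^bsub>G\<^esub> y"
proof
  assume "gdist G x y = 1"
  then obtain p where "awalk x p y" "length p = Suc 0" using gdist_awalk[OF assms] by auto
  then obtain e where "awalk x [e] y" by (auto simp: length_Suc_conv)
  then show "x \<rightarrow>\<^bsub>G\<^esub> y" by (auto simp: awalk_simps dest: in_arcs_imp_in_arcs_ends)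
next
  assume xy: "x \<rightarrow>\<^bsub>G\<^esub> y"
  obtain e where e: "awalk x [e] y" using dominates_awalk[OF xy] by blast
  have "gdist G x y \<le> 1" using gdist_le[OF e] by simp
  moreover have "x \<noteq> y" using xy no_loops by (auto simp: arcs_ends_conv)
  then have "gdist G x y \<noteq> 0" using gdist_0_iff assms by simp
  ultimately show "gdist G x y = 1" by simp
qed

lemma gdist_step:
  assumes "x \<in> verts G" "y \<in> verts G" "gdist G x y = Suc i"
  shows "\<exists>z\<in>verts G. gdist G x z = i \<and> gdist G z y = 1"
proof -
  obtain p where p: "awalk x p y" "length p = Suc i" using gdist_awalk[OF assms(1,2)] assms(3) by auto
  then obtain p' e where "p = p' @ [e]" by (metis length_Suc_conv_rev)
  then have pe: "awalk x p' (tail G e)" "e \<in> arcs G" "y = head G e" "length p' = i"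
    using p by (auto simp: awalk_simps)
  have z: "tail G e \<in> verts G" using pe by simp
  have "tail G e \<rightarrow>\<^bsub>G\<^esub> y" using pe in_arcs_imp_in_arcs_ends by simp
  then have 1: "gdist G (tail G e) y = 1" using gdist_1_iff[OF z assms(2)] by simp
  have "gdist G x (tail G e) \<le> i" using gdist_le[OF pe(1)] pe(4) by simp
  moreover have "Suc i \<le> gdist G x (tail G e) + 1" using gdist_triangle[OF assms(1) z assms(2)] 1 assms(3) by simp
  ultimately show ?thesis using z 1 by (intro bexI[of _ "tail G e"]) auto
qed

end

lemma gdiam_bounds:
  assumes "verts G \<noteq> {}"
  shows "x \<in> verts G \<Longrightarrow> y \<in> verts G \<Longrightarrow> gdist G x y \<le> gdiam G"
    and "\<exists>x\<in>verts G. \<exists>y\<in>verts G. gdist G x y = gdiam G"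
proof -
  let ?S = "{gdist G x y | x y. x \<in> verts G \<and> y \<in> verts G}"
  have eq: "?S = (\<lambda>(x, y). gdist G x y) ` (verts G \<times> verts G)" by auto
  have fin: "finite ?S" unfolding eq by simp
  show "gdist G x y \<le> gdiam G" if "x \<in> verts G" "y \<in> verts G"
    unfolding gdiam_def using that by (intro Max_ge[OF fin]) blast
  have "?S \<noteq> {}" using assms by auto
  from Max_in[OF fin this] have "gdiam G \<in> ?S" unfolding gdiam_def .
  then show "\<exists>x\<in>verts G. \<exists>y\<in>verts G. gdist G x y = gdiam G" by force
qed

lemma out_degree_induced:
  assumes "S \<subseteq> verts G" "y \<in> S"
  shows "out_degree (G \<restriction> S) y = card {z \<in> S. y \<rightarrow>\<^bsub>G\<^esub> z}"
proof -
  have "bij_betw (head G) (out_arcs (G \<restriction> S) y) {z \<in> S. y \<rightarrow>\<^bsub>G\<^esub> z}"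
  proof (rule bij_betw_imageI)
    show "inj_on (head G) (out_arcs (G \<restriction> S) y)"
      using no_multi_arcs by (auto simp: inj_on_def out_arcs_def arc_to_ends_def)
    show "head G ` out_arcs (G \<restriction> S) y = {z \<in> S. y \<rightarrow>\<^bsub>G\<^esub> z}"
      using assms(2) by (auto simp: out_arcs_def arcs_ends_conv image_iff)
  qed
  then show ?thesis unfolding out_degree_def by (rule bij_betw_same_card)
qed

lemma dominates_induced: "y \<rightarrow>\<^bsub>G \<restriction> S\<^esub> z \<longleftrightarrow> y \<in> S \<and> z \<in> S \<and> y \<rightarrow>\<^bsub>G\<^esub> z"
  by (auto simp: arcs_ends_conv image_iff)

end

section \<open>The bound for antipodal tight graphs\<close>

lemma inter_numbers:
  assumes "distance_regular G" "i \<le> gdiam G"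
  shows "is_a G i (SOME n. is_a G i n)" "is_b G i (SOME n. is_b G i n)" "is_c G i (SOME n. is_c G i n)"
  using assms unfolding distance_regular_def by (blast intro: someI_ex)+

text \<open>
  The intersection numbers are chosen at every index separately, which makes them total functions;
  up to the diameter they are the true ones.
\<close>

lemma AT4_antipodal_drg:
  fixes G :: "('v, 'e) pre_digraph" and r :: int
  assumes at: "AT4 G p q r"
  defines "a \<equiv> \<lambda>i. SOME n. is_a G i n" and "b \<equiv> \<lambda>i. SOME n. is_b G i n" and "c \<equiv> \<lambda>i. SOME n. is_c G i n"
  shows "antipodal_drg (verts G) (gdist G) a b c (nat r)"
proof -
  have dr: "distance_regular G" and diam: "gdiam G = 4" and cov: "antipodal_cover G r"
    using at unfolding AT4_def tight_def by auto
  have gr: "graph G" and conn: "Digraph_Component.connected G"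
    using dr unfolding distance_regular_def by auto
  interpret graph G by (rule gr)
  have ne: "verts G \<noteq> {}" using conn unfolding connected_def strongly_connected_def by simp
  have le: "gdist G x y \<le> 4" if "x \<in> verts G" "y \<in> verts G" for x y
    using gdiam_bounds(1)[OF ne that] diam by simp
  have sph: "gsphere G i x \<inter> gsphere G 1 y = {z \<in> verts G. gdist G x z = i \<and> gdist G y z = 1}" for i x y
    by (auto simp: gsphere_def)
  have ia: "is_a G i (a i)" and ib: "is_b G i (b i)" and ic: "is_c G i (c i)" if "i \<le> gdiam G" for i
    unfolding a_def b_def c_def using inter_numbers[OF dr that] by this
  show ?thesis
  proof
    show "\<exists>x\<in>verts G. \<exists>y\<in>verts G. gdist G x y = 4" using gdiam_bounds(2)[OF ne] diam by simp
    fix x y assume xy: "x \<in> verts G" "y \<in> verts G"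
    have i: "gdist G x y \<le> gdiam G" using le[OF xy] diam by simp
    show "card {z \<in> verts G. gdist G x z = gdist G x y \<and> gdist G y z = 1} = a (gdist G x y)"
      using ia[unfolded is_a_def sph, rule_format, OF i xy refl] .
    show "card {z \<in> verts G. gdist G x z = Suc (gdist G x y) \<and> gdist G y z = 1} = b (gdist G x y)"
      using ib[unfolded is_b_def sph, rule_format, OF i xy refl] by simp
    show "gdist G x y = 0 \<longleftrightarrow> x = y" by (rule gdist_0_iff[OF conn xy])
    show "gdist G x y = gdist G y x" by (rule gdist_sym[OF conn xy])
    show "gdist G x y \<le> 4" by (rule le[OF xy])
    fix j assume j: "gdist G x y = Suc j"
    show "\<exists>z\<in>verts G. gdist G x z = j \<and> gdist G z y = 1" by (rule gdist_step[OF conn xy j])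
    show "card {z \<in> verts G. gdist G x z = j \<and> gdist G y z = 1} = c (Suc j)"
      using ic[unfolded is_c_def sph, rule_format, OF i xy refl] j by simp
  next
    fix x y z assume "x \<in> verts G" "y \<in> verts G" "z \<in> verts G"
    then show "gdist G x z \<le> gdist G x y + gdist G y z" by (rule gdist_triangle[OF conn])
  next
    fix x y z assume "x \<in> verts G" "y \<in> verts G" "z \<in> verts G" "gdist G x y = 4" "gdist G x z = 4"
    then show "y = z \<or> gdist G y z = 4"
      using cov diam unfolding antipodal_cover_def Defs.antipodal_def by metis
  next
    fix x assume x: "x \<in> verts G"
    have "antipodal_class G x = insert x {z \<in> verts G. gdist G x z = 4}"
      using gdist_0_iff[OF conn x] x diam by (auto simp: antipodal_class_def)
    moreover have "gdist G x x = 0" using gdist_0_iff[OF conn x x] by simp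
    ultimately have "card (antipodal_class G x) = card {z \<in> verts G. gdist G x z = 4} + 1" by simp
    moreover have "int (card (antipodal_class G x)) = r" using cov x unfolding antipodal_cover_def by blast
    ultimately show "card {z \<in> verts G. gdist G x z = 4} + 1 = nat r" by simp
  qed (simp_all)
qed

theorem corollary3p6:
  fixes q s :: int
  assumes "\<exists>G :: ('v, 'e) pre_digraph. AT4 G (real_of_int (q * s)) (real_of_int q) q"
  shows "s \<le> q"
proof -
  obtain G :: "('v, 'e) pre_digraph" where at: "AT4 G (real_of_int (q * s)) (real_of_int q) q"
    using assms by blast
  define a b c where "a = (\<lambda>i. SOME n. is_a G i n)" and "b = (\<lambda>i. SOME n. is_b G i n)"
    and "c = (\<lambda>i. SOME n. is_c G i n)"
  interpret A: antipodal_drg "verts G" "gdist G" a b c "nat q"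
    unfolding a_def b_def c_def by (rule AT4_antipodal_drg[OF at])
  have tight: "tight G" and diam: "gdiam G = 4" and dr: "distance_regular G"
    and pq: "real_of_int (q * s) > - real_of_int q"
    and loc: "\<And>x. x \<in> verts G \<Longrightarrow> nontrivial_eigenvalues (local_graph G x) = {real_of_int (q * s), - real_of_int q}"
    using at unfolding AT4_def tight_def by auto
  have gr: "graph G" and conn: "Digraph_Component.connected G"
    using dr unfolding distance_regular_def by auto
  interpret graph G by (rule gr)
  have nbrs: "A.nbrs x = gsphere G 1 x" for x by (simp add: A.nbrs_def gsphere_def)
  have nbrs_dom: "A.nbrs x = {y. y \<in> verts G \<and> x \<rightarrow>\<^bsub>G\<^esub> y}" if "x \<in> verts G" for x
    using gdist_1_iff[OF conn that] by (auto simp: A.nbrs_def)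
  have q2: "2 \<le> nat q" by (rule A.r_ge_2)
  have inter: "inter_a G 1 = a 1" "inter_b G 1 = b 1" "inter_b G 0 = b 0"
  proof -
    have I: "is_a G 1 (a 1)" "is_b G 1 (b 1)" "is_b G 0 (b 0)"
      unfolding a_def b_def by (rule inter_numbers[OF dr], simp add: diam)+
    obtain x y where "x \<in> verts G" "y \<in> verts G" "gdist G x y = 1" using A.pair_at[of 1] by auto
    then have "is_a G 1 n \<Longrightarrow> n = a 1" "is_b G 1 n \<Longrightarrow> n = b 1" for n
      using I(1,2) unfolding is_a_def is_b_def by auto
    then show "inter_a G 1 = a 1" "inter_b G 1 = b 1" unfolding inter_a_def inter_b_def
      using I by (blast intro: the_equality)+
    obtain x y where "x \<in> verts G" "y \<in> verts G" "gdist G x y = 0" using A.pair_at[of 0] by auto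
    then have "is_b G 0 n \<Longrightarrow> n = b 0" for n using I(3) unfolding is_b_def by auto
    then show "inter_b G 0 = b 0" unfolding inter_b_def using I by (blast intro: the_equality)
  qed
  have eig: "graph_eigenvalue G t \<longleftrightarrow> (\<exists>f. (\<exists>x\<in>verts G. f x \<noteq> 0) \<and> A.eigfun t f)" for t
    unfolding graph_eigenvalue_def A.eigfun_def using nbrs_dom by (simp cong: ball_cong)
  obtain \<theta> :: "nat \<Rightarrow> real" where th: "\<theta> ` {0..4} = {t. \<exists>f. (\<exists>x\<in>verts G. f x \<noteq> 0) \<and> A.eigfun t f}"
    "\<theta> 0 = real (b 0)" "\<And>i. i < 4 \<Longrightarrow> \<theta> (Suc i) < \<theta> i"
    "(\<theta> 1 + real (b 0) / (real (a 1) + 1)) * (\<theta> 4 + real (b 0) / (real (a 1) + 1)) =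
      - (real (b 0) * real (a 1) * real (b 1) / (real (a 1) + 1)\<^sup>2)"
    using tight unfolding tight_def Let_def diam inter eig by blast
  obtain P Q :: real where PQ: "0 \<le> P" "1 < Q" and kPQ: "real (b 0) = Q * (P * Q + P + Q)"
    and aPQ: "real (a 1) = P * (Q + 1)" and c2: "real (nat q) * real (c 2) = Q * (P + Q)"
    and roots: "(P * Q + P + Q)\<^sup>2 - real (a 1) * (P * Q + P + Q) - real (b 0) = 0"
      "(- (Q\<^sup>2))\<^sup>2 - real (a 1) * - (Q\<^sup>2) - real (b 0) + real (nat q) * real (c 2) * (- (Q\<^sup>2) + 1) = 0"
    by (rule A.tight_parameters[OF th])
  note codeg = A.local_codegree[OF PQ kPQ aPQ roots]
  obtain x where x: "x \<in> verts G" using A.d_far by blast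
  have local: "t = P \<or> t = - Q" if t: "t \<in> {real_of_int (q * s), - real_of_int q}" for t
  proof -
    have sub: "A.nbrs x \<subseteq> verts G" by (auto simp: A.nbrs_def)
    have lg: "local_graph G x = G \<restriction> A.nbrs x" by (simp add: local_graph_def nbrs)
    have adj: "{z \<in> A.nbrs x. y \<rightarrow>\<^bsub>G\<^esub> z} = {z \<in> A.nbrs x. gdist G y z = 1}" if "y \<in> A.nbrs x" for y
      using gdist_1_iff[OF conn] that sub by blast
    have t: "graph_eigenvalue (local_graph G x) t"
      and nt: "t \<notin> {real k | k. \<forall>y\<in>verts (local_graph G x). out_degree (local_graph G x) y = k}"
      using t loc[OF x] unfolding nontrivial_eigenvalues_def by blast+
    have "out_degree (local_graph G x) y = a 1" if "y \<in> A.nbrs x" for y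
      unfolding lg using out_degree_induced[OF sub that] A.local_valency[OF x that] adj[OF that] by simp
    then have ta: "t \<noteq> real (a 1)" using nt by (auto simp: lg)
    obtain f y where f: "y \<in> A.nbrs x" "f y \<noteq> 0"
      "\<And>y. y \<in> A.nbrs x \<Longrightarrow> (\<Sum>z | z \<in> A.nbrs x \<and> y \<rightarrow>\<^bsub>local_graph G x\<^esub> z. f z) = t * f y"
      using t unfolding graph_eigenvalue_def by (auto simp: lg)
    have ev: "(\<Sum>z\<in>{z \<in> A.nbrs x. gdist G y z = 1}. f z) = t * f y" if "y \<in> A.nbrs x" for y
    proof -
      have "{z. z \<in> A.nbrs x \<and> y \<rightarrow>\<^bsub>local_graph G x\<^esub> z} = {z \<in> A.nbrs x. gdist G y z = 1}"
        unfolding lg dominates_induced using adj[OF that] that by auto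
      then show ?thesis using f(3)[OF that] by simp
    qed
    show ?thesis
      by (rule A.local_eigenvalue[where f = f and y = y, OF aPQ x _ _ f(1,2) ta])
        (erule (2) codeg[OF x], erule ev)
  qed
  \<comment> \<open>Both prescribed eigenvalues are among \<open>P\<close> and \<open>-Q\<close>, and \<open>qs > -q\<close> decides which is which.\<close>
  have "real_of_int (q * s) = P" "- real_of_int q = - Q"
    using local[of "real_of_int (q * s)"] local[of "- real_of_int q"] pq PQ by auto
  then have P: "P = real_of_int (q * s)" and Q: "Q = real_of_int q" by auto
  show "s \<le> q"
  proof (cases "s \<le> 0")
    case True then show ?thesis using q2 by simp
  next
    case False
    define n m where "n = nat q" and "m = nat s"
    have nm: "q = int n" "s = int m" "2 \<le> n" "1 \<le> m" using False q2 by (auto simp: n_def m_def)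
    have PQ': "P = real (n * m)" "Q = real n" using P Q nm by auto
    have "m \<le> n"
    proof (rule A.at4_bound[OF nm(3,4)])
      have "real (b 0) = real (n\<^sup>2 * (n * m + m + 1))"
        using kPQ unfolding PQ' by (simp add: algebra_simps power2_eq_square)
      then show "b 0 = n\<^sup>2 * (n * m + m + 1)" by linarith
      have "real (a 1) = real (n * m * (n + 1))" using aPQ unfolding PQ' by (simp add: algebra_simps)
      then show "a 1 = n * m * (n + 1)" by linarith
      have "real n * real (c 2) = real n * real (n * (m + 1))"
        using c2 unfolding PQ' n_def[symmetric] by (simp add: algebra_simps)
      then show "c 2 = n * (m + 1)" using nm(3) by (simp del: of_nat_mult of_nat_add)
    next
      fix x y w assume "x \<in> verts G" "y \<in> A.nbrs x" "w \<in> A.nbrs x" "y \<noteq> w" "gdist G y w = 1"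
      then have "real (card ({z \<in> A.nbrs x. gdist G y z = 1} \<inter> {z \<in> A.nbrs x. gdist G w z = 1})) = 2 * P - Q"
        using codeg by simp
      then have "real (card ({z \<in> A.nbrs x. gdist G y z = 1} \<inter> {z \<in> A.nbrs x. gdist G w z = 1}) + n) = real (2 * n * m)"
        unfolding PQ' by simp
      then show "card ({z \<in> A.nbrs x. gdist G y z = 1} \<inter> {z \<in> A.nbrs x. gdist G w z = 1}) + n = 2 * n * m"
        by (simp only: of_nat_eq_iff)
    next
      fix x y w assume "x \<in> verts G" "y \<in> A.nbrs x" "w \<in> A.nbrs x" "y \<noteq> w" "gdist G y w \<noteq> 1"
      then have "real (card ({z \<in> A.nbrs x. gdist G y z = 1} \<inter> {z \<in> A.nbrs x. gdist G w z = 1})) = P"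
        using codeg by simp
      then show "card ({z \<in> A.nbrs x. gdist G y z = 1} \<inter> {z \<in> A.nbrs x. gdist G w z = 1}) = n * m"
        unfolding PQ' by (simp only: of_nat_eq_iff)
    qed
    then show ?thesis using nm by simp
  qed
qed

end
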